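(* The problem of deciding whether three given partition matroids on a common ground set have a common basis reduces in polynomial time to the problem of deciding whether the optimum value of a given instance of Common Matroid-constrained Multiway Cut equals $0$.
   Context: A partition matroid on $S$ with classes $U_1,\dots,U_r$ (partition of $S$) has as independent sets the sets meeting each class in at most one element. Common Matroid-constrained Multiway Cut: given a graph $G=(V,E)$, edge weights $w\in\mathbb{R}^E_{\ge 0}$, and two rank-$k$ matroids $\mathcal{M}_1,\mathcal{M}_2$ on $V$ given by independence oracles with basis families $\mathcal{B}_1,\mathcal{B}_2$, find a partition $\{V_1,\dots,V_k\}$ of $V$ for which there exists $B\in\mathcal{B}_1\cap\mathcal{B}_2$ with $|B\cap V_i|=1$ for all $i\in[k]$, minimizing $\sum_{i=1}^k d_w(V_i)$, where $d_w(X)$ is the total weight of edges with exactly one endpoint in $X$. *)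

theory Defs
  imports
    "HOL-Library.Disjoint_Sets"
    "HOL-Library.Extended_Real"
    "HOL-Computational_Algebra.Polynomial"
begin

section \<open>Matroids\<close>

definition matroid :: "'a set \<Rightarrow> 'a set set \<Rightarrow> bool" where
  "matroid V \<I> \<longleftrightarrow> finite V \<and> \<I> \<subseteq> Pow V \<and> {} \<in> \<I> \<and>
     (\<forall>X\<in>\<I>. \<forall>Y. Y \<subseteq> X \<longrightarrow> Y \<in> \<I>) \<and>
     (\<forall>X\<in>\<I>. \<forall>Y\<in>\<I>. card X < card Y \<longrightarrow> (\<exists>y\<in>Y - X. insert y X \<in> \<I>))"

definition bases :: "'a set set \<Rightarrow> 'a set set" where
  "bases \<I> = {B \<in> \<I>. \<forall>X\<in>\<I>. B \<subseteq> X \<longrightarrow> X = B}"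

definition matroid_rank :: "'a set set \<Rightarrow> nat" where
  "matroid_rank \<I> = Max (card ` \<I>)"

definition partition_matroid :: "'a set \<Rightarrow> 'a set set \<Rightarrow> 'a set set" where
  "partition_matroid S \<U> = {X. X \<subseteq> S \<and> (\<forall>U\<in>\<U>. card (X \<inter> U) \<le> 1)}"

section \<open>Common Matroid-constrained Multiway Cut\<close>

definition cut_weight :: "'a set set \<Rightarrow> ('a set \<Rightarrow> real) \<Rightarrow> 'a set \<Rightarrow> real" where
  "cut_weight E w X = (\<Sum>e | e \<in> E \<and> card (e \<inter> X) = 1. w e)"

definition cmmc_instance ::
  "'a set \<Rightarrow> 'a set set \<Rightarrow> ('a set \<Rightarrow> real) \<Rightarrow> 'a set set \<Rightarrow> 'a set set \<Rightarrow> nat \<Rightarrow> bool" where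
  "cmmc_instance V E w \<I>1 \<I>2 k \<longleftrightarrow>
     finite V \<and> (\<forall>e\<in>E. e \<subseteq> V \<and> card e = 2) \<and> (\<forall>e\<in>E. 0 \<le> w e) \<and>
     matroid V \<I>1 \<and> matroid_rank \<I>1 = k \<and> matroid V \<I>2 \<and> matroid_rank \<I>2 = k"

definition cmmc_feasible :: "'a set \<Rightarrow> 'a set set \<Rightarrow> 'a set set \<Rightarrow> nat \<Rightarrow> 'a set set \<Rightarrow> bool" where
  "cmmc_feasible V \<I>1 \<I>2 k \<P> \<longleftrightarrow>
     partition_on V \<P> \<and> card \<P> = k \<and>
     (\<exists>B \<in> bases \<I>1 \<inter> bases \<I>2. \<forall>X\<in>\<P>. card (B \<inter> X) = 1)"

text \<open>The optimum of an infeasible instance is \<open>\<infinity>\<close>.\<close>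

definition cmmc_opt ::
  "'a set \<Rightarrow> 'a set set \<Rightarrow> ('a set \<Rightarrow> real) \<Rightarrow> 'a set set \<Rightarrow> 'a set set \<Rightarrow> nat \<Rightarrow> ereal" where
  "cmmc_opt V E w \<I>1 \<I>2 k =
     (INF \<P> \<in> {\<P>. cmmc_feasible V \<I>1 \<I>2 k \<P>}. ereal (\<Sum>X\<in>\<P>. cut_weight E w X))"

section \<open>Polynomial time\<close>

text \<open>
  Deterministic multi-tape Turing machines with two-way infinite tapes. The symbols
  \<open>Work i\<close> never occur in encodings; they only allow a machine to choose an arbitrary
  finite tape alphabet. A tape is its contents together with the head position.
\<close>

datatype sym = Blank | Zero | One | Comma | Semicolon | Slash | Work nat

datatype move = MLeft | Stay | MRight

record tm =
  tapes :: nat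
  states :: "nat set"
  alphabet :: "sym set"
  start :: nat
  halt :: nat
  delta :: "nat \<Rightarrow> sym list \<Rightarrow> nat \<times> (sym \<times> move) list"

definition wf_tm :: "tm \<Rightarrow> bool" where
  "wf_tm M \<longleftrightarrow>
     tapes M \<ge> 1 \<and> finite (states M) \<and> start M \<in> states M \<and> halt M \<in> states M \<and>
     finite (alphabet M) \<and> {Blank, Zero, One, Comma, Semicolon, Slash} \<subseteq> alphabet M \<and>
     (\<forall>q \<in> states M. \<forall>as. length as = tapes M \<and> set as \<subseteq> alphabet M \<longrightarrow>
        (case delta M q as of (q', acts) \<Rightarrow>
           q' \<in> states M \<and> length acts = tapes M \<and> fst ` set acts \<subseteq> alphabet M))"

type_synonym tape = "(int \<Rightarrow> sym) \<times> int"
type_synonym config = "nat \<times> tape list"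

fun shift :: "move \<Rightarrow> int" where
  "shift MLeft = -1" | "shift Stay = 0" | "shift MRight = 1"

fun act :: "sym \<times> move \<Rightarrow> tape \<Rightarrow> tape" where
  "act (a, m) (t, h) = (t(h := a), h + shift m)"

fun step :: "tm \<Rightarrow> config \<Rightarrow> config" where
  "step M (q, ts) =
     (if q = halt M then (q, ts)
      else case delta M q (map (\<lambda>(t, h). t h) ts) of (q', acts) \<Rightarrow> (q', map2 act acts ts))"

definition word_tape :: "sym list \<Rightarrow> tape" where
  "word_tape u = ((\<lambda>i. if 0 \<le> i \<and> i < int (length u) then u ! nat i else Blank), 0)"

definition init_config :: "tm \<Rightarrow> sym list \<Rightarrow> config" where
  "init_config M u = (start M, word_tape u # replicate (tapes M - 1) (word_tape []))"

text \<open>The output is the maximal blank-free word to the right of, and including, the head cell.\<close>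

definition tape_output :: "tape \<Rightarrow> sym list \<Rightarrow> bool" where
  "tape_output \<tau> v \<longleftrightarrow> (case \<tau> of (t, h) \<Rightarrow>
     Blank \<notin> set v \<and> (\<forall>i < length v. t (h + int i) = v ! i) \<and> t (h + int (length v)) = Blank)"

text \<open>Halting configurations are fixed by \<open>step\<close>, so \<open>n\<close> is an upper bound on the running time.\<close>

definition computes_within :: "tm \<Rightarrow> sym list \<Rightarrow> sym list \<Rightarrow> nat \<Rightarrow> bool" where
  "computes_within M u v n \<longleftrightarrow>
     (case (step M ^^ n) (init_config M u) of (q, ts) \<Rightarrow> q = halt M \<and> tape_output (ts ! 0) v)"

definition polytime_computable ::
  "'a set \<Rightarrow> ('a \<Rightarrow> sym list) \<Rightarrow> ('b \<Rightarrow> sym list) \<Rightarrow> ('a \<Rightarrow> 'b) \<Rightarrow> bool" where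
  "polytime_computable D enc_in enc_out f \<longleftrightarrow>
     (\<exists>M (p :: nat poly). wf_tm M \<and>
        (\<forall>x\<in>D. computes_within M (enc_in x) (enc_out (f x)) (poly p (length (enc_in x)))))"

section \<open>Encodings\<close>

text \<open>
  Ground sets are \<open>{..<n}\<close> and are written in unary; subsets are characteristic vectors
  of length \<open>n\<close>. Edge weights are reduced fractions of binary numbers.
\<close>

definition enc_bool :: "bool \<Rightarrow> sym list" where
  "enc_bool b = [if b then One else Zero]"

definition enc_set :: "nat \<Rightarrow> nat set \<Rightarrow> sym list" where
  "enc_set n X = map (\<lambda>i. if i \<in> X then One else Zero) [0..<n]"

fun enc_nat :: "nat \<Rightarrow> sym list" where
  "enc_nat m = (if m < 2 then [if m = 1 then One else Zero]
                else enc_nat (m div 2) @ [if odd m then One else Zero])"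

definition enc_rat :: "rat \<Rightarrow> sym list" where
  "enc_rat r = (case quotient_of r of (a, b) \<Rightarrow> enc_nat (nat a) @ Slash # enc_nat (nat b))"

text \<open>Three partition matroids: the size of the ground set and the classes of each matroid.\<close>

type_synonym pm_triple = "nat \<times> nat set list \<times> nat set list \<times> nat set list"

fun pm_triple_instance :: "pm_triple \<Rightarrow> bool" where
  "pm_triple_instance (n, Us1, Us2, Us3) \<longleftrightarrow>
     (\<forall>Us \<in> {Us1, Us2, Us3}. distinct Us \<and> partition_on {..<n} (set Us))"

fun has_common_basis :: "pm_triple \<Rightarrow> bool" where
  "has_common_basis (n, Us1, Us2, Us3) \<longleftrightarrow>
     (\<exists>B. \<forall>Us \<in> {Us1, Us2, Us3}. B \<in> bases (partition_matroid {..<n} (set Us)))"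

definition enc_classes :: "nat \<Rightarrow> nat set list \<Rightarrow> sym list" where
  "enc_classes n Us = concat (map (\<lambda>U. Comma # enc_set n U) Us)"

fun enc_pm_triple :: "pm_triple \<Rightarrow> sym list" where
  "enc_pm_triple (n, Us1, Us2, Us3) =
     enc_set n {..<n} @ Semicolon # enc_classes n Us1 @
     Semicolon # enc_classes n Us2 @ Semicolon # enc_classes n Us3"

text \<open>Weighted graphs: the number of vertices and the list of edges with their weights.\<close>

type_synonym wgraph = "nat \<times> (nat set \<times> rat) list"

fun wg_verts :: "wgraph \<Rightarrow> nat set" where
  "wg_verts (n, es) = {..<n}"

fun wg_edges :: "wgraph \<Rightarrow> nat set set" where
  "wg_edges (n, es) = fst ` set es"

fun wg_weight :: "wgraph \<Rightarrow> nat set \<Rightarrow> real" where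
  "wg_weight (n, es) e = (case map_of es e of Some r \<Rightarrow> real_of_rat r | None \<Rightarrow> 0)"

fun wf_wgraph :: "wgraph \<Rightarrow> bool" where
  "wf_wgraph (n, es) \<longleftrightarrow> distinct (map fst es)"

fun enc_wgraph :: "wgraph \<Rightarrow> sym list" where
  "enc_wgraph (n, es) =
     enc_set n {..<n} @ concat (map (\<lambda>(e, r). Semicolon # enc_set n e @ Comma # enc_rat r) es)"

section \<open>Reductions to a problem with oracle input\<close>

text \<open>
  The graph of the target instance is written out in full. Its matroids are given by independence
  oracles, so what a polynomial-time reduction has to supply for them is an algorithm that, from
  the source instance \<open>x\<close> and a vertex set \<open>X\<close> of the target graph, answers the query
  whether \<open>X\<close> is independent, in time polynomial in the length of \<open>x\<close> and \<open>X\<close>.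
\<close>

definition polytime_oracle ::
  "'a set \<Rightarrow> ('a \<Rightarrow> sym list) \<Rightarrow> ('a \<Rightarrow> wgraph) \<Rightarrow> ('a \<Rightarrow> nat set set) \<Rightarrow> bool" where
  "polytime_oracle D enc G \<I> \<longleftrightarrow>
     polytime_computable {(x, X). x \<in> D \<and> X \<subseteq> wg_verts (G x)}
       (\<lambda>(x, X). enc x @ Semicolon # enc_set (card (wg_verts (G x))) X)
       enc_bool (\<lambda>(x, X). X \<in> \<I> x)"

end

theory Submission
  imports Defs
begin

text \<open>
  Pair every element \<open>s\<close> of the ground set \<open>S\<close> with a twin \<open>s'\<close>. A transversal of these pairs
  encodes the set \<open>A\<close> of those \<open>s\<close> that it contains, and \<open>A\<close> is a basis of a matroid iff the twins
  in the transversal form a basis of its dual. If the pairs are the edges of the graph and there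
  are as many parts as edges, then a feasible partition of value \<open>0\<close> forces the common basis to be
  a transversal. So \<open>M1 \<oplus> M1*\<close> and \<open>M2 \<oplus> M3*\<close> on \<open>S \<union> S'\<close> have such a common basis iff \<open>M1\<close>,
  \<open>M2\<close> and \<open>M3\<close> have one. The ranks of these two sums differ in general; therefore the construction
  is doubled, with \<open>M1 \<oplus> M1*\<close> and \<open>M3 \<oplus> M2*\<close> on the second half. Now both ranks are
  \<open>2 * card S\<close>, the number of pairs, whatever the ranks of the three matroids are. In the dual of
  a partition matroid a class \<open>U\<close> simply has capacity \<open>card U - 1\<close> instead of \<open>1\<close>.

  The Turing machines come from programs that operate on stacks. A control state is the list of
  commands still to be executed; a program has only finitely many of them.
\<close>

section \<open>Capacitated partition matroids\<close>

definition capacity_matroid :: "'i set \<Rightarrow> ('i \<Rightarrow> 'a set) \<Rightarrow> ('i \<Rightarrow> nat) \<Rightarrow> 'a set set" where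
  "capacity_matroid I U c = {X. X \<subseteq> (\<Union>i\<in>I. U i) \<and> (\<forall>i\<in>I. card (X \<inter> U i) \<le> c i)}"

locale capacitated_partition =
  fixes I :: "'i set" and U :: "'i \<Rightarrow> 'a set" and c :: "'i \<Rightarrow> nat"
  assumes finite_index: "finite I" and finite_class: "i \<in> I \<Longrightarrow> finite (U i)"
    and disjoint_classes: "disjoint_family_on U I"
    and capacity_le_card: "i \<in> I \<Longrightarrow> c i \<le> card (U i)"
begin

abbreviation ground :: "'a set" where
  "ground \<equiv> \<Union>i\<in>I. U i"

abbreviation indep :: "'a set set" where
  "indep \<equiv> capacity_matroid I U c"

lemma finite_ground: "finite ground"
  using finite_index finite_class by auto

lemma finite_indep: "finite indep"
proof -
  have "indep \<subseteq> Pow ground" by (auto simp: capacity_matroid_def)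
  then show ?thesis using finite_ground by (simp add: finite_subset)
qed

lemma card_eq_sum_classes:
  assumes "X \<subseteq> ground"
  shows "card X = (\<Sum>i\<in>I. card (X \<inter> U i))"
proof -
  have "card (\<Union>i\<in>I. X \<inter> U i) = (\<Sum>i\<in>I. card (X \<inter> U i))"
    using finite_index finite_class disjoint_classes
    by (intro card_UN_disjoint) (auto simp: disjoint_family_on_def)
  moreover have "(\<Union>i\<in>I. X \<inter> U i) = X" using assms by auto
  ultimately show ?thesis by simp
qed

lemma card_indep_le:
  assumes "X \<in> indep"
  shows "card X \<le> (\<Sum>i\<in>I. c i)"
  using assms card_eq_sum_classes[of X] by (auto simp: capacity_matroid_def intro: sum_mono)

lemma indep_subset:
  assumes "X \<in> indep" "Y \<subseteq> X"
  shows "Y \<in> indep"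
proof -
  have "card (Y \<inter> U i) \<le> card (X \<inter> U i)" if "i \<in> I" for i
    using assms(2) finite_class[OF that] by (intro card_mono) auto
  then show ?thesis using assms by (fastforce simp: capacity_matroid_def)
qed

lemma insert_indep:
  assumes "X \<in> indep" "i \<in> I" "x \<in> U i" "card (X \<inter> U i) < c i"
  shows "insert x X \<in> indep"
proof -
  have "card (insert x X \<inter> U k) \<le> c k" if "k \<in> I" for k
  proof (cases "k = i")
    case True
    then show ?thesis using assms finite_class by (simp add: card_insert_if)
  next
    case False
    then have "x \<notin> U k" using assms disjoint_classes that by (auto simp: disjoint_family_on_def)
    then show ?thesis using assms(1) that by (simp add: capacity_matroid_def)
  qed
  then show ?thesis using assms by (auto simp: capacity_matroid_def)
qed

lemma indep_augment:
  assumes "X \<in> indep" "Y \<in> indep" "card X < card Y"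
  obtains y where "y \<in> Y - X" "insert y X \<in> indep"
proof -
  obtain i where i: "i \<in> I" "card (X \<inter> U i) < card (Y \<inter> U i)"
  proof (rule ccontr)
    assume "\<not> thesis"
    then have "(\<Sum>i\<in>I. card (Y \<inter> U i)) \<le> (\<Sum>i\<in>I. card (X \<inter> U i))"
      by (intro sum_mono) (use that linorder_not_less in blast)
    then show False
      using assms card_eq_sum_classes[of X] card_eq_sum_classes[of Y]
      by (simp add: capacity_matroid_def)
  qed
  then obtain y where y: "y \<in> Y \<inter> U i" "y \<notin> X \<inter> U i"
    using card_mono[of "X \<inter> U i" "Y \<inter> U i"] finite_class by fastforce
  have "card (X \<inter> U i) < c i" using i assms(2) by (fastforce simp: capacity_matroid_def)
  then show thesis using y i(1) assms(1) by (intro that[of y] insert_indep) auto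
qed

lemma matroid_indep: "matroid ground indep"
  unfolding matroid_def
proof (intro conjI ballI allI impI)
  show "X \<in> indep \<Longrightarrow> Y \<subseteq> X \<Longrightarrow> Y \<in> indep" for X Y by (rule indep_subset)
  show "X \<in> indep \<Longrightarrow> Y \<in> indep \<Longrightarrow> card X < card Y \<Longrightarrow> \<exists>y\<in>Y - X. insert y X \<in> indep" for X Y
    by (meson indep_augment)
qed (use finite_ground in \<open>auto simp: capacity_matroid_def\<close>)

lemma bases_indep: "bases indep = {B. B \<subseteq> ground \<and> (\<forall>i\<in>I. card (B \<inter> U i) = c i)}"
proof (intro set_eqI iffI)
  fix B assume "B \<in> bases indep"
  then have B: "B \<in> indep" and maximal: "\<And>X. X \<in> indep \<Longrightarrow> B \<subseteq> X \<Longrightarrow> X = B"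
    by (auto simp: bases_def)
  have "card (B \<inter> U i) = c i" if i: "i \<in> I" for i
  proof (rule ccontr)
    assume "card (B \<inter> U i) \<noteq> c i"
    then have less: "card (B \<inter> U i) < c i"
      using B i by (simp add: capacity_matroid_def le_neq_implies_less)
    then have "card (B \<inter> U i) < card (U i)" using capacity_le_card[OF i] by simp
    then obtain x where x: "x \<in> U i" "x \<notin> B" by (metis inf.absorb2 less_irrefl subsetI)
    then show False using maximal[OF insert_indep[OF B i x(1) less]] by blast
  qed
  then show "B \<in> {B. B \<subseteq> ground \<and> (\<forall>i\<in>I. card (B \<inter> U i) = c i)}"
    using B by (simp add: capacity_matroid_def)
next
  fix B assume "B \<in> {B. B \<subseteq> ground \<and> (\<forall>i\<in>I. card (B \<inter> U i) = c i)}"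
  then have B: "B \<in> indep" "card B = (\<Sum>i\<in>I. c i)"
    using card_eq_sum_classes[of B] by (auto simp: capacity_matroid_def)
  have "X = B" if X: "X \<in> indep" "B \<subseteq> X" for X
  proof -
    have "finite X"
      using X(1) finite_ground by (auto simp: capacity_matroid_def intro: finite_subset)
    then show ?thesis using card_seteq[OF _ X(2)] card_indep_le[OF X(1)] B(2) by simp
  qed
  then show "B \<in> bases indep" using B(1) by (simp add: bases_def)
qed

lemma rank_indep: "matroid_rank indep = (\<Sum>i\<in>I. c i)"
proof -
  have "\<exists>B\<subseteq>U i. card B = c i" if "i \<in> I" for i
    using obtain_subset_with_card_n[OF capacity_le_card[OF that]] by metis
  then obtain B where B: "\<And>i. i \<in> I \<Longrightarrow> B i \<subseteq> U i" "\<And>i. i \<in> I \<Longrightarrow> card (B i) = c i"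
    by metis
  have "(\<Union>i\<in>I. B i) \<inter> U k = B k" if k: "k \<in> I" for k
  proof -
    have "B i \<inter> U k = {}" if "i \<in> I" "i \<noteq> k" for i
      using B(1)[OF that(1)] disjoint_classes that k by (auto simp: disjoint_family_on_def)
    then show ?thesis using B(1)[OF k] k by auto
  qed
  then have "(\<Union>i\<in>I. B i) \<subseteq> ground" "\<forall>i\<in>I. card ((\<Union>i\<in>I. B i) \<inter> U i) = c i"
    using B by auto
  then have "(\<Union>i\<in>I. B i) \<in> indep" "card (\<Union>i\<in>I. B i) = (\<Sum>i\<in>I. c i)"
    using card_eq_sum_classes[of "\<Union>i\<in>I. B i"] by (simp_all add: capacity_matroid_def)
  then show ?thesis
    unfolding matroid_rank_def using finite_indep card_indep_le
    by (intro Max_eqI) (auto intro: rev_image_eqI)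
qed

end

lemma partition_on_classD:
  assumes "partition_on S \<U>" "finite S" "U \<in> \<U>"
  shows "U \<subseteq> S" "finite U" "1 \<le> card U"
proof -
  show "U \<subseteq> S" using assms(1,3) by (auto simp: partition_on_def)
  then show "finite U" using assms(2) by (rule finite_subset)
  moreover have "U \<noteq> {}" using assms(1,3) by (auto simp: partition_on_def)
  ultimately show "1 \<le> card U" by (simp add: Suc_le_eq card_gt_0_iff)
qed

lemma capacitated_partition_partition_on:
  assumes "partition_on S \<U>" "finite S"
  shows "capacitated_partition \<U> (\<lambda>U. U) (\<lambda>_. 1)"
proof
  show "finite \<U>" using assms finite_elements by blast
  show "disjoint_family_on (\<lambda>U. U) \<U>"
    using assms(1) by (auto simp: partition_on_def disjoint_def disjoint_family_on_def)
qed (rule partition_on_classD[OF assms]; assumption)+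

lemma bases_partition_matroid:
  assumes "partition_on S \<U>" "finite S"
  shows "bases (partition_matroid S \<U>) = {B. B \<subseteq> S \<and> (\<forall>U\<in>\<U>. card (B \<inter> U) = 1)}"
proof -
  interpret capacitated_partition \<U> "\<lambda>U. U" "\<lambda>_. 1"
    by (rule capacitated_partition_partition_on[OF assms])
  have "ground = S" using assms(1) by (auto simp: partition_on_def)
  then show ?thesis using bases_indep by (simp add: partition_matroid_def capacity_matroid_def)
qed

lemma card_eq_sum_partition_on:
  assumes "partition_on S \<U>" "finite S" "X \<subseteq> S"
  shows "card X = (\<Sum>U\<in>\<U>. card (X \<inter> U))"
proof -
  interpret capacitated_partition \<U> "\<lambda>U. U" "\<lambda>_. 1"
    by (rule capacitated_partition_partition_on[OF assms(1,2)])
  show ?thesis using card_eq_sum_classes[of X] assms by (auto simp: partition_on_def)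
qed

section \<open>Multiway cuts of value zero\<close>

lemma cut_weight_nonneg: "\<forall>e\<in>E. 0 \<le> w e \<Longrightarrow> 0 \<le> cut_weight E w X"
  by (auto simp: cut_weight_def intro: sum_nonneg)

lemma cut_weight_eq_0_iff:
  assumes "finite E" "\<forall>e\<in>E. 0 < w e"
  shows "cut_weight E w X = 0 \<longleftrightarrow> (\<forall>e\<in>E. card (e \<inter> X) \<noteq> 1)"
  using assms unfolding cut_weight_def
  by (subst sum_nonneg_eq_0_iff) (auto intro: less_imp_le)

lemma cmmc_opt_eq_0_iff:
  assumes "finite V" "\<forall>e\<in>E. 0 \<le> w e"
  shows "cmmc_opt V E w \<I>1 \<I>2 k = 0 \<longleftrightarrow>
    (\<exists>\<P>. cmmc_feasible V \<I>1 \<I>2 k \<P> \<and> (\<forall>X\<in>\<P>. cut_weight E w X = 0))"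
proof -
  let ?F = "{\<P>. cmmc_feasible V \<I>1 \<I>2 k \<P>}" and ?val = "\<lambda>\<P>. ereal (\<Sum>X\<in>\<P>. cut_weight E w X)"
  have finite_parts: "finite \<P>" if "\<P> \<in> ?F" for \<P>
    using that assms(1) finite_elements by (auto simp: cmmc_feasible_def)
  have finite_feasible: "finite ?F"
    by (rule finite_subset[of _ "Pow (Pow V)"])
      (use assms(1) in \<open>auto simp: cmmc_feasible_def partition_on_def\<close>)
  have val_0: "?val \<P> = 0 \<longleftrightarrow> (\<forall>X\<in>\<P>. cut_weight E w X = 0)" if "\<P> \<in> ?F" for \<P>
    using finite_parts[OF that] cut_weight_nonneg[OF assms(2)] by (simp add: sum_nonneg_eq_0_iff)
  have val_nonneg: "0 \<le> ?val \<P>" for \<P>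
    using cut_weight_nonneg[OF assms(2)] by (simp add: sum_nonneg)
  show ?thesis
  proof
    assume opt: "cmmc_opt V E w \<I>1 \<I>2 k = 0"
    have "?F \<noteq> {}"
    proof
      assume "?F = {}"
      then have "cmmc_opt V E w \<I>1 \<I>2 k = top" by (simp only: cmmc_opt_def) simp
      then show False using opt by (simp add: top_ereal_def)
    qed
    then have "cmmc_opt V E w \<I>1 \<I>2 k \<in> ?val ` ?F"
      unfolding cmmc_opt_def using finite_feasible
      by (metis (no_types, lifting) Min_Inf Min_in finite_imageI image_is_empty)
    then show "\<exists>\<P>. cmmc_feasible V \<I>1 \<I>2 k \<P> \<and> (\<forall>X\<in>\<P>. cut_weight E w X = 0)"
      using opt val_0 by (auto simp del: ereal_eq_0)
  next
    assume "\<exists>\<P>. cmmc_feasible V \<I>1 \<I>2 k \<P> \<and> (\<forall>X\<in>\<P>. cut_weight E w X = 0)"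
    then obtain \<P> where "\<P> \<in> ?F" "?val \<P> = 0" using val_0 by auto
    then have "cmmc_opt V E w \<I>1 \<I>2 k \<le> 0" unfolding cmmc_opt_def by (metis INF_lower)
    moreover have "0 \<le> cmmc_opt V E w \<I>1 \<I>2 k"
      unfolding cmmc_opt_def using val_nonneg by (rule INF_greatest)
    ultimately show "cmmc_opt V E w \<I>1 \<I>2 k = 0" by simp
  qed
qed

lemma transversal_refines:
  assumes V: "finite V" and refines: "refines V \<Q> \<P>" and card: "card \<Q> = card \<P>"
    and B: "\<And>X. X \<in> \<P> \<Longrightarrow> card (B \<inter> X) = 1" and Y: "Y \<in> \<Q>"
  shows "card (B \<inter> Y) = 1"
proof -
  have parts: "partition_on V \<P>" "partition_on V \<Q>" using refines by (simp_all add: refines_def)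
  have le: "card (B \<inter> Z) \<le> 1" if Z: "Z \<in> \<Q>" for Z
  proof -
    obtain X where X: "X \<in> \<P>" "Z \<subseteq> X" using refines Z by (auto simp: refines_def)
    then have "card (B \<inter> Z) \<le> card (B \<inter> X)"
      using partition_on_classD(2)[OF parts(1) V X(1)] by (intro card_mono) auto
    then show ?thesis using B[OF X(1)] by simp
  qed
  have sum: "card (B \<inter> V) = (\<Sum>X\<in>\<U>. card (B \<inter> X))" if "partition_on V \<U>" for \<U>
  proof -
    have "B \<inter> V \<inter> X = B \<inter> X" if "X \<in> \<U>" for X
      using partition_on_classD(1)[OF \<open>partition_on V \<U>\<close> V that] by auto
    then show ?thesis using card_eq_sum_partition_on[OF that V, of "B \<inter> V"] by simp
  qed
  have "(\<Sum>Y\<in>\<Q>. card (B \<inter> Y)) = (\<Sum>X\<in>\<P>. card (B \<inter> X))"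
    using sum[OF parts(1)] sum[OF parts(2)] by simp
  also have "\<dots> = (\<Sum>Y\<in>\<Q>. 1)" using B card by simp
  finally show ?thesis
    using sum_mono_inv[OF _ le Y finite_elements[OF V parts(2)]] by simp
qed

lemma uncut_pair_subset:
  assumes "card e = 2" "card (e \<inter> X) \<noteq> 1" "v \<in> e" "v \<in> X"
  shows "e \<subseteq> X"
  using assms by (auto simp: card_2_iff Int_insert_left split: if_splits)

theorem cmmc_opt_perfect_matching_eq_0_iff:
  assumes V: "finite V" "partition_on V E" and E: "\<forall>e\<in>E. card e = 2" "\<forall>e\<in>E. 0 < w e"
  shows "cmmc_opt V E w \<I>1 \<I>2 (card E) = 0 \<longleftrightarrow>
    (\<exists>B\<in>bases \<I>1 \<inter> bases \<I>2. \<forall>e\<in>E. card (B \<inter> e) = 1)"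
proof -
  have "finite E" using V finite_elements by blast
  then have opt: "cmmc_opt V E w \<I>1 \<I>2 (card E) = 0 \<longleftrightarrow>
      (\<exists>\<P>. cmmc_feasible V \<I>1 \<I>2 (card E) \<P> \<and> (\<forall>X\<in>\<P>. \<forall>e\<in>E. card (e \<inter> X) \<noteq> 1))"
    using cmmc_opt_eq_0_iff[OF V(1), of E w] cut_weight_eq_0_iff[OF _ E(2)] E(2)
    by (simp add: less_imp_le)
  show ?thesis
  proof
    assume "cmmc_opt V E w \<I>1 \<I>2 (card E) = 0"
    then obtain \<P> B where \<P>: "partition_on V \<P>" "card E = card \<P>"
      and uncut: "\<And>X e. X \<in> \<P> \<Longrightarrow> e \<in> E \<Longrightarrow> card (e \<inter> X) \<noteq> 1"
      and B: "B \<in> bases \<I>1 \<inter> bases \<I>2" "\<And>X. X \<in> \<P> \<Longrightarrow> card (B \<inter> X) = 1"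
      unfolding opt cmmc_feasible_def by metis
    have "\<exists>X\<in>\<P>. e \<subseteq> X" if e: "e \<in> E" for e
    proof -
      have "e \<noteq> {}" using E(1) e by auto
      then obtain v where v: "v \<in> e" by blast
      then have "v \<in> V" using partition_on_classD(1)[OF V(2,1) e] by blast
      then obtain X where "X \<in> \<P>" "v \<in> X" using \<P>(1) by (auto simp: partition_on_def)
      then show ?thesis using uncut_pair_subset[of e X v] uncut E(1) e v by blast
    qed
    then have "refines V E \<P>" using V(2) \<P>(1) by (simp add: refines_def)
    then show "\<exists>B\<in>bases \<I>1 \<inter> bases \<I>2. \<forall>e\<in>E. card (B \<inter> e) = 1"
      using transversal_refines[OF V(1) _ \<P>(2) B(2)] B(1) by blast
  next
    assume "\<exists>B\<in>bases \<I>1 \<inter> bases \<I>2. \<forall>e\<in>E. card (B \<inter> e) = 1"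
    then have "cmmc_feasible V \<I>1 \<I>2 (card E) E" using V(2) by (simp add: cmmc_feasible_def)
    moreover have "card (e \<inter> X) \<noteq> 1" if "X \<in> E" "e \<in> E" for X e
    proof (cases "X = e")
      case False
      then have "e \<inter> X = {}" using V(2) that by (auto simp: partition_on_def disjoint_def)
      then show ?thesis by simp
    qed (use E(1) that in simp)
    ultimately show "cmmc_opt V E w \<I>1 \<I>2 (card E) = 0" unfolding opt by blast
  qed
qed

section \<open>Four copies of the ground set\<close>

definition slice :: "nat \<Rightarrow> nat set \<Rightarrow> nat set" where
  "slice j X = {i. 4 * i + j \<in> X}"

definition copy :: "nat \<Rightarrow> nat set \<Rightarrow> nat set" where
  "copy j U = (\<lambda>i. 4 * i + j) ` U"

lemma card_copy: "card (copy j U) = card U"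
  by (simp add: copy_def card_image inj_on_def)

lemma card_Int_copy: "card (X \<inter> copy j U) = card (slice j X \<inter> U)"
proof -
  have "X \<inter> copy j U = copy j (slice j X \<inter> U)" by (auto simp: copy_def slice_def)
  then show ?thesis by (simp add: card_copy)
qed

definition capacity :: "nat \<Rightarrow> nat set \<Rightarrow> nat" where
  "capacity j U = (if even j then 1 else card U - 1)"

definition fits :: "nat \<Rightarrow> nat set \<Rightarrow> nat set \<Rightarrow> bool" where
  "fits j U X \<longleftrightarrow> card (slice j X \<inter> U) \<le> capacity j U"

lemma card_Diff_Int_eq_capacity_iff:
  assumes "odd j" "U \<subseteq> S" "finite U" "1 \<le> card U"
  shows "card ((S - A) \<inter> U) = capacity j U \<longleftrightarrow> card (A \<inter> U) = 1"
proof -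
  have "(S - A) \<inter> U = U - A" using assms(2) by auto
  moreover have "card U = card (A \<inter> U) + card (U - A)"
    using assms(3) by (metis Int_commute card_Int_Diff)
  ultimately show ?thesis using assms(1,4) by (auto simp: capacity_def)
qed

text \<open>The direct sum of the partition matroids with classes \<open>\<Q> 0\<close> and \<open>\<Q> 2\<close> and the duals of those
  with classes \<open>\<Q> 1\<close> and \<open>\<Q> 3\<close>.\<close>

definition lifted_matroid :: "(nat \<Rightarrow> nat set set) \<Rightarrow> nat set set" where
  "lifted_matroid \<Q> =
     capacity_matroid (SIGMA j:{..<4}. \<Q> j) (\<lambda>(j, U). copy j U) (\<lambda>(j, U). capacity j U)"

locale four_partitions =
  fixes n :: nat and \<Q> :: "nat \<Rightarrow> nat set set"
  assumes partition: "j < 4 \<Longrightarrow> partition_on {..<n} (\<Q> j)"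
begin

lemmas classD = partition_on_classD[OF partition finite_lessThan]

lemma Union_copies: "(\<Union>(j, U)\<in>(SIGMA j:{..<4}. \<Q> j). copy j U) = {..<4 * n}"
proof (intro set_eqI iffI)
  fix v assume "v \<in> (\<Union>(j, U)\<in>(SIGMA j:{..<4}. \<Q> j). copy j U)"
  then obtain j U i where "j < 4" "U \<in> \<Q> j" "i \<in> U" and v: "v = 4 * i + j"
    by (auto simp: copy_def)
  then have "i < n" using classD(1) by blast
  then show "v \<in> {..<4 * n}" using v \<open>j < 4\<close> by simp
next
  fix v assume "v \<in> {..<4 * n}"
  then have "v div 4 \<in> {..<n}" by auto
  then obtain U where "U \<in> \<Q> (v mod 4)" "v div 4 \<in> U"
    using partition[of "v mod 4"] by (auto simp: partition_on_def)
  moreover from this have "v \<in> copy (v mod 4) U"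
    by (auto simp: copy_def intro!: image_eqI[of _ _ "v div 4"])
  ultimately show "v \<in> (\<Union>(j, U)\<in>(SIGMA j:{..<4}. \<Q> j). copy j U)"
    by (intro UN_I[of "(v mod 4, U)"]) auto
qed

lemma disjoint_copies: "disjoint_family_on (\<lambda>(j, U). copy j U) (SIGMA j:{..<4}. \<Q> j)"
  unfolding disjoint_family_on_def
proof (intro ballI impI, clarify, rule ccontr)
  fix j U k W
  assume jk: "j < (4::nat)" "k < (4::nat)" and UW: "U \<in> \<Q> j" "W \<in> \<Q> k" "\<not> (j = k \<and> U = W)"
    and "copy j U \<inter> copy k W \<noteq> {}"
  then obtain i i' where i: "i \<in> U" "i' \<in> W" "4 * i + j = 4 * i' + k" by (auto simp: copy_def)
  then have "j = k" "i = i'" using jk by presburger+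
  then show False
    using UW i(1,2) partition[OF jk(1)] by (auto simp: partition_on_def disjoint_def)
qed

sublocale capacitated_partition "SIGMA j:{..<4}. \<Q> j" "\<lambda>(j, U). copy j U" "\<lambda>(j, U). capacity j U"
proof
  show "finite (SIGMA j:{..<4}. \<Q> j)" using finite_elements[OF _ partition] by auto
  fix i assume "i \<in> (SIGMA j:{..<4}. \<Q> j)"
  then obtain j U where i: "i = (j, U)" "j < 4" "U \<in> \<Q> j" by auto
  then show "finite (case i of (j, U) \<Rightarrow> copy j U)"
    "(case i of (j, U) \<Rightarrow> capacity j U) \<le> card (case i of (j, U) \<Rightarrow> copy j U)"
    using classD(2,3)[OF i(2,3)] by (auto simp: card_copy capacity_def) (simp add: copy_def)
qed (rule disjoint_copies)

lemma matroid_lifted: "matroid {..<4 * n} (lifted_matroid \<Q>)"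
  using matroid_indep unfolding lifted_matroid_def Union_copies .

lemma lifted_matroid_iff:
  "X \<in> lifted_matroid \<Q> \<longleftrightarrow> X \<subseteq> {..<4 * n} \<and> (\<forall>j<4. \<forall>U\<in>\<Q> j. fits j U X)"
  unfolding lifted_matroid_def capacity_matroid_def Union_copies
  by (auto simp: card_Int_copy fits_def)

lemma bases_lifted_iff:
  "B \<in> bases (lifted_matroid \<Q>) \<longleftrightarrow>
    B \<subseteq> {..<4 * n} \<and> (\<forall>j<4. \<forall>U\<in>\<Q> j. card (slice j B \<inter> U) = capacity j U)"
  unfolding lifted_matroid_def bases_indep Union_copies by (auto simp: card_Int_copy)

lemma sum_card_classes:
  assumes "j < 4"
  shows "(\<Sum>U\<in>\<Q> j. card U) = n"
  using card_eq_sum_partition_on[OF partition[OF assms], of "{..<n}"] classD(1)[OF assms]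
  by (simp add: Int_absorb1)

lemma sum_capacity:
  assumes "j < 4"
  shows "(\<Sum>U\<in>\<Q> j. capacity j U) = (if even j then card (\<Q> j) else n - card (\<Q> j))"
  using sum_subtractf_nat[of "\<Q> j" "\<lambda>_. 1" card] sum_card_classes[OF assms] classD(3)[OF assms]
  by (simp add: capacity_def)

lemma rank_lifted:
  assumes "card (\<Q> 0) + card (\<Q> 2) = card (\<Q> 1) + card (\<Q> 3)"
  shows "matroid_rank (lifted_matroid \<Q>) = 2 * n"
proof -
  have le: "card (\<Q> j) \<le> n" if "j < 4" for j
    using sum_mono[of "\<Q> j" "\<lambda>_. 1" card] sum_card_classes[OF that] classD(3)[OF that] by simp
  have "matroid_rank (lifted_matroid \<Q>) = (\<Sum>j<4. \<Sum>U\<in>\<Q> j. capacity j U)"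
    unfolding lifted_matroid_def rank_indep
    using finite_elements[OF _ partition] by (subst sum.Sigma) auto
  also have "\<dots> = (\<Sum>j\<in>{0, 1, 2, 3}. \<Sum>U\<in>\<Q> j. capacity j U)"
    by (rule sum.cong) auto
  also have "\<dots> = 2 * n"
    using assms le[of 1] le[of 3] sum_capacity[of 0] sum_capacity[of 1] sum_capacity[of 2]
      sum_capacity[of 3]
    by simp
  finally show ?thesis .
qed

end

definition matching_graph :: "nat \<Rightarrow> wgraph" where
  "matching_graph N = (2 * N, map (\<lambda>m. ({2 * m, 2 * m + 1}, 1)) [0..<N])"

lemma wg_verts_matching_graph: "wg_verts (matching_graph N) = {..<2 * N}"
  by (simp add: matching_graph_def)

lemma wg_edges_matching_graph: "wg_edges (matching_graph N) = (\<lambda>m. {2 * m, 2 * m + 1}) ` {..<N}"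
  by (simp add: matching_graph_def image_image lessThan_atLeast0)

lemma inj_matching_edge: "inj (\<lambda>m::nat. {2 * m, 2 * m + 1})"
  by (auto simp: inj_on_def doubleton_eq_iff)

lemma card_wg_edges_matching_graph: "card (wg_edges (matching_graph N)) = N"
  using inj_on_subset[OF inj_matching_edge] by (simp add: wg_edges_matching_graph card_image)

lemma wf_matching_graph: "wf_wgraph (matching_graph N)"
  using inj_on_subset[OF inj_matching_edge] by (simp add: matching_graph_def distinct_map o_def)

lemma wg_weight_matching_graph:
  assumes "e \<in> wg_edges (matching_graph N)"
  shows "wg_weight (matching_graph N) e = 1"
proof -
  have "map_of (map (\<lambda>m. ({2 * m, 2 * m + 1}, 1)) [0..<N]) e = Some (1::rat)"
    using assms wf_matching_graph[of N]
    by (subst map_of_eq_Some_iff) (auto simp: matching_graph_def)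
  then show ?thesis by (simp add: matching_graph_def)
qed

lemma partition_on_matching_graph:
  "partition_on (wg_verts (matching_graph N)) (wg_edges (matching_graph N))"
proof (rule partition_onI)
  show "\<Union> (wg_edges (matching_graph N)) = wg_verts (matching_graph N)"
    unfolding wg_verts_matching_graph
  proof (intro set_eqI iffI)
    fix v assume "v \<in> {..<2 * N}"
    then have "v div 2 < N" "v \<in> {2 * (v div 2), 2 * (v div 2) + 1}" by auto
    then show "v \<in> \<Union> (wg_edges (matching_graph N))" unfolding wg_edges_matching_graph by blast
  qed (auto simp: wg_edges_matching_graph)
qed (auto simp: wg_edges_matching_graph disjnt_def, presburger+)

lemma card_Int_matching_edge:
  "card (B \<inter> {2 * m, 2 * m + 1}) = 1 \<longleftrightarrow> (2 * m \<in> B \<longleftrightarrow> 2 * m + 1 \<notin> (B :: nat set))"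
  by (auto simp: Int_insert_right)

text \<open>The transversals of the matching correspond to pairs of subsets of \<open>{..<n}\<close>; the following one
  represents \<open>A\<close> on both of its halves.\<close>

definition transversal :: "nat \<Rightarrow> nat set \<Rightarrow> nat set" where
  "transversal n A = {v. v < 4 * n \<and> (v div 4 \<in> A \<longleftrightarrow> even v)}"

lemma slice_transversal:
  assumes "j < 4" "A \<subseteq> {..<n}"
  shows "slice j (transversal n A) = (if even j then A else {..<n} - A)"
  using assms by (auto simp: slice_def transversal_def)

lemma card_Int_transversal:
  assumes "e \<in> wg_edges (matching_graph (2 * n))"
  shows "card (transversal n A \<inter> e) = 1"
proof -
  obtain m where m: "m < 2 * n" "e = {2 * m, 2 * m + 1}"
    using assms by (auto simp: wg_edges_matching_graph)
  have "(2 * m) div 4 = m div 2" "(2 * m + 1) div 4 = m div 2" by presburger+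
  then have "2 * m \<in> transversal n A \<longleftrightarrow> 2 * m + 1 \<notin> transversal n A"
    using m(1) by (simp add: transversal_def)
  then show ?thesis unfolding m(2) card_Int_matching_edge .
qed

lemma slice_1_eq_Diff:
  assumes "B \<subseteq> {..<4 * n}" "\<forall>e\<in>wg_edges (matching_graph (2 * n)). card (B \<inter> e) = 1"
  shows "slice 1 B = {..<n} - slice 0 B"
proof -
  have "i \<in> slice 1 B \<longleftrightarrow> i \<notin> slice 0 B" if "i < n" for i
  proof -
    have "{2 * (2 * i), 2 * (2 * i) + 1} \<in> wg_edges (matching_graph (2 * n))"
      using that by (auto simp: wg_edges_matching_graph)
    then have "2 * (2 * i) \<in> B \<longleftrightarrow> 2 * (2 * i) + 1 \<notin> B"
      using assms(2) card_Int_matching_edge by blast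
    then show ?thesis by (simp add: slice_def)
  qed
  moreover have "slice 1 B \<subseteq> {..<n}" using assms(1) by (auto simp: slice_def)
  ultimately show ?thesis by auto
qed

lemma (in four_partitions) transversal_in_bases_lifted:
  assumes "A \<subseteq> {..<n}" "\<And>j U. j < 4 \<Longrightarrow> U \<in> \<Q> j \<Longrightarrow> card (A \<inter> U) = 1"
  shows "transversal n A \<in> bases (lifted_matroid \<Q>)"
proof -
  have "card (slice j (transversal n A) \<inter> U) = capacity j U" if "j < 4" "U \<in> \<Q> j" for j U
    using assms that classD[OF that] card_Diff_Int_eq_capacity_iff[of j U "{..<n}" A]
    by (simp add: slice_transversal capacity_def)
  moreover have "transversal n A \<subseteq> {..<4 * n}" by (auto simp: transversal_def)
  ultimately show ?thesis by (simp add: bases_lifted_iff)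
qed

lemma (in four_partitions) card_slice_0_Int:
  assumes B: "B \<in> bases (lifted_matroid \<Q>)"
    and paired: "\<forall>e\<in>wg_edges (matching_graph (2 * n)). card (B \<inter> e) = 1"
    and U: "U \<in> \<Q> 0 \<union> \<Q> 1"
  shows "card (slice 0 B \<inter> U) = 1"
proof (cases "U \<in> \<Q> 0")
  case True
  then have "card (slice 0 B \<inter> U) = capacity 0 U" using B by (simp add: bases_lifted_iff)
  then show ?thesis by (simp add: capacity_def)
next
  case False
  then have "U \<in> \<Q> 1" using U by blast
  then have "card (slice 1 B \<inter> U) = capacity 1 U" using B by (simp add: bases_lifted_iff)
  moreover have "slice 1 B = {..<n} - slice 0 B"
    using B paired by (intro slice_1_eq_Diff) (simp_all add: bases_lifted_iff)
  ultimately show ?thesis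
    using card_Diff_Int_eq_capacity_iff[of 1 U "{..<n}"] classD[OF _ \<open>U \<in> \<Q> 1\<close>] by simp
qed

section \<open>The reduction\<close>

fun classes :: "pm_triple \<Rightarrow> nat \<Rightarrow> nat set list" where
  "classes (n, Us1, Us2, Us3) s = [Us1, Us2, Us3] ! s"

lemma partition_on_classes:
  assumes "pm_triple_instance x" "s < 3"
  shows "partition_on {..<fst x} (set (classes x s))"
  using assms by (cases x) (auto simp: less_Suc_eq numeral_3_eq_3)

lemma has_common_basis_iff:
  assumes "pm_triple_instance x"
  shows "has_common_basis x \<longleftrightarrow>
    (\<exists>A\<subseteq>{..<fst x}. \<forall>s<3. \<forall>U\<in>set (classes x s). card (A \<inter> U) = 1)"
proof -
  have "has_common_basis x \<longleftrightarrow>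
      (\<exists>B. \<forall>s<3. B \<in> bases (partition_matroid {..<fst x} (set (classes x s))))"
    by (cases x) (simp add: numeral_3_eq_3 All_less_Suc2)
  also have "\<dots> \<longleftrightarrow> (\<exists>B. \<forall>s<3. B \<subseteq> {..<fst x} \<and> (\<forall>U\<in>set (classes x s). card (B \<inter> U) = 1))"
    using partition_on_classes[OF assms] bases_partition_matroid[of "{..<fst x}"] by simp
  also have "\<dots> \<longleftrightarrow> (\<exists>B\<subseteq>{..<fst x}. \<forall>s<3. \<forall>U\<in>set (classes x s). card (B \<inter> U) = 1)"
    by (metis zero_less_numeral)
  finally show ?thesis .
qed

definition copied_classes :: "(nat \<Rightarrow> nat) \<Rightarrow> pm_triple \<Rightarrow> nat \<Rightarrow> nat set set" where
  "copied_classes src x j = set (classes x (src j))"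

lemma four_partitions_copied_classes:
  assumes "pm_triple_instance x" "\<And>j. j < 4 \<Longrightarrow> src j < 3"
  shows "four_partitions (fst x) (copied_classes src x)"
  using partition_on_classes[OF assms(1)] assms(2) by unfold_locales (simp add: copied_classes_def)

definition first_source :: "nat \<Rightarrow> nat" where
  "first_source j = 0"

definition second_source :: "nat \<Rightarrow> nat" where
  "second_source j = (if j = 0 \<or> j = 3 then 1 else 2)"

lemma source_less_3: "first_source j < 3" "second_source j < 3"
  by (simp_all add: first_source_def second_source_def)

definition pairing_graph :: "pm_triple \<Rightarrow> wgraph" where
  "pairing_graph x = matching_graph (2 * fst x)"

definition first_matroid :: "pm_triple \<Rightarrow> nat set set" where
  "first_matroid x = lifted_matroid (copied_classes first_source x)"

definition second_matroid :: "pm_triple \<Rightarrow> nat set set" where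
  "second_matroid x = lifted_matroid (copied_classes second_source x)"

lemma card_slice_0_Int_classes:
  assumes x: "pm_triple_instance x"
    and B: "B \<in> bases (first_matroid x)" "B \<in> bases (second_matroid x)"
    and paired: "\<forall>e\<in>wg_edges (pairing_graph x). card (B \<inter> e) = 1"
    and U: "s < 3" "U \<in> set (classes x s)"
  shows "card (slice 0 B \<inter> U) = 1"
proof -
  interpret first: four_partitions "fst x" "copied_classes first_source x"
    by (rule four_partitions_copied_classes[OF x source_less_3(1)])
  interpret second: four_partitions "fst x" "copied_classes second_source x"
    by (rule four_partitions_copied_classes[OF x source_less_3(2)])
  have "s = 0 \<or> s = 1 \<or> s = 2" using U(1) by linarith
  then have "U \<in> copied_classes first_source x 0 \<or>
      U \<in> copied_classes second_source x 0 \<union> copied_classes second_source x 1"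
    using U(2) by (auto simp: copied_classes_def first_source_def second_source_def)
  then show ?thesis
    using B paired first.card_slice_0_Int[of B U] second.card_slice_0_Int[of B U]
    unfolding first_matroid_def second_matroid_def pairing_graph_def by blast
qed

lemma has_common_basis_iff_pairing:
  assumes x: "pm_triple_instance x"
  shows "has_common_basis x \<longleftrightarrow> (\<exists>B\<in>bases (first_matroid x) \<inter> bases (second_matroid x).
    \<forall>e\<in>wg_edges (pairing_graph x). card (B \<inter> e) = 1)"
    (is "_ \<longleftrightarrow> ?paired")
proof -
  let ?n = "fst x"
  interpret first: four_partitions ?n "copied_classes first_source x"
    by (rule four_partitions_copied_classes[OF x source_less_3(1)])
  interpret second: four_partitions ?n "copied_classes second_source x"
    by (rule four_partitions_copied_classes[OF x source_less_3(2)])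
  show ?thesis
  proof
    assume "has_common_basis x"
    then obtain A where A: "A \<subseteq> {..<?n}" "\<forall>s<3. \<forall>U\<in>set (classes x s). card (A \<inter> U) = 1"
      using has_common_basis_iff[OF x] by blast
    then have "card (A \<inter> U) = 1" if "src j < 3" "U \<in> copied_classes src x j" for src j U
      using that by (simp add: copied_classes_def)
    then have "transversal ?n A \<in> bases (first_matroid x) \<inter> bases (second_matroid x)"
      using first.transversal_in_bases_lifted[OF A(1)] second.transversal_in_bases_lifted[OF A(1)]
        source_less_3
      unfolding first_matroid_def second_matroid_def by blast
    then show ?paired using card_Int_transversal unfolding pairing_graph_def by blast
  next
    assume ?paired
    then obtain B where B: "B \<in> bases (first_matroid x)" "B \<in> bases (second_matroid x)"
      and paired: "\<forall>e\<in>wg_edges (pairing_graph x). card (B \<inter> e) = 1"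
      by blast
    have "card (slice 0 B \<inter> U) = 1" if "s < 3" "U \<in> set (classes x s)" for s U
      using card_slice_0_Int_classes[OF x B paired that] .
    moreover have "slice 0 B \<subseteq> {..<?n}"
      using B(1) by (auto simp: first_matroid_def first.bases_lifted_iff slice_def)
    ultimately show "has_common_basis x" using has_common_basis_iff[OF x] by blast
  qed
qed

theorem pairing_reduction:
  assumes x: "pm_triple_instance x"
  defines "V \<equiv> wg_verts (pairing_graph x)" and "E \<equiv> wg_edges (pairing_graph x)"
    and "w \<equiv> wg_weight (pairing_graph x)"
  shows "cmmc_instance V E w (first_matroid x) (second_matroid x) (2 * fst x)"
    and "has_common_basis x \<longleftrightarrow>
      cmmc_opt V E w (first_matroid x) (second_matroid x) (2 * fst x) = 0"
proof -
  interpret first: four_partitions "fst x" "copied_classes first_source x"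
    by (rule four_partitions_copied_classes[OF x source_less_3(1)])
  interpret second: four_partitions "fst x" "copied_classes second_source x"
    by (rule four_partitions_copied_classes[OF x source_less_3(2)])
  have V: "V = {..<4 * fst x}" by (simp add: V_def pairing_graph_def wg_verts_matching_graph)
  have E: "\<forall>e\<in>E. card e = 2" "\<forall>e\<in>E. w e = 1" "card E = 2 * fst x"
    using wg_weight_matching_graph card_wg_edges_matching_graph
    by (auto simp: E_def w_def pairing_graph_def wg_edges_matching_graph)
  have partition: "partition_on V E"
    unfolding V_def E_def pairing_graph_def by (rule partition_on_matching_graph)
  have "matroid_rank (first_matroid x) = 2 * fst x" "matroid_rank (second_matroid x) = 2 * fst x"
    unfolding first_matroid_def second_matroid_def
    by (rule first.rank_lifted second.rank_lifted;
        simp add: copied_classes_def first_source_def second_source_def)+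
  then show "cmmc_instance V E w (first_matroid x) (second_matroid x) (2 * fst x)"
    using E partition V first.matroid_lifted second.matroid_lifted
    by (auto simp: cmmc_instance_def first_matroid_def second_matroid_def partition_on_def)
  show "has_common_basis x \<longleftrightarrow>
      cmmc_opt V E w (first_matroid x) (second_matroid x) (2 * fst x) = 0"
    using cmmc_opt_perfect_matching_eq_0_iff[OF _ partition E(1)] E(2,3) V
      has_common_basis_iff_pairing[OF x]
    by (simp add: E_def)
qed

section \<open>Programs over stacks\<close>

datatype 'i com =
    Skip
  | Pop 'i
  | Push 'i sym
  | Move 'i 'i
  | Write 'i sym
  | Seq "'i com" "'i com" (infixr ";;" 60)
  | Cond 'i "sym set" "'i com" "'i com"
  | While 'i "sym set" "'i com"

type_synonym 'i store = "'i \<Rightarrow> sym list"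

definition peek :: "sym list \<Rightarrow> sym" where
  "peek xs = nth_default Blank xs 0"

lemma peek_simps [simp]: "peek [] = Blank" "peek (x # xs) = x"
  by (simp_all add: peek_def)

text \<open>\<open>exec p \<sigma> t \<sigma>'\<close> bounds the running time by \<open>t\<close>. There is no rule for \<open>Write\<close>: it is the second
  half of a \<open>Push\<close> or \<open>Move\<close>, which a Turing machine cannot perform in a single step.\<close>

inductive exec :: "'i com \<Rightarrow> 'i store \<Rightarrow> nat \<Rightarrow> 'i store \<Rightarrow> bool" where
  Skip: "exec Skip \<sigma> 1 \<sigma>"
| Pop: "exec (Pop i) \<sigma> 1 (\<sigma>(i := tl (\<sigma> i)))"
| Push: "exec (Push i s) \<sigma> 2 (\<sigma>(i := s # \<sigma> i))"
| Move: "i \<noteq> j \<Longrightarrow> exec (Move i j) \<sigma> 2 (\<sigma>(i := tl (\<sigma> i), j := peek (\<sigma> i) # \<sigma> j))"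
| Seq: "exec p \<sigma> t \<sigma>' \<Longrightarrow> exec q \<sigma>' u \<sigma>'' \<Longrightarrow> exec (p ;; q) \<sigma> (t + u + 1) \<sigma>''"
| Cond_True: "peek (\<sigma> i) \<in> A \<Longrightarrow> exec p \<sigma> t \<sigma>' \<Longrightarrow> exec (Cond i A p q) \<sigma> (t + 1) \<sigma>'"
| Cond_False: "peek (\<sigma> i) \<notin> A \<Longrightarrow> exec q \<sigma> t \<sigma>' \<Longrightarrow> exec (Cond i A p q) \<sigma> (t + 1) \<sigma>'"
| While_False: "peek (\<sigma> i) \<notin> A \<Longrightarrow> exec (While i A p) \<sigma> 1 \<sigma>"
| While_True: "peek (\<sigma> i) \<in> A \<Longrightarrow> exec p \<sigma> t \<sigma>' \<Longrightarrow> exec (While i A p) \<sigma>' u \<sigma>'' \<Longrightarrow>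
    exec (While i A p) \<sigma> (t + u + 1) \<sigma>''"
| weaken: "exec p \<sigma> t \<sigma>' \<Longrightarrow> t \<le> u \<Longrightarrow> exec p \<sigma> u \<sigma>'"

section \<open>Compilation to Turing machines\<close>

definition symbols :: "sym set" where
  "symbols = {Blank, Zero, One, Comma, Semicolon, Slash}"

text \<open>The top of the stack is the symbol under the head. What lies to the left of the head is
  irrelevant, but it is uncovered for a moment when a symbol is pushed.\<close>

definition stack_on_tape :: "sym list \<Rightarrow> tape \<Rightarrow> bool" where
  "stack_on_tape xs \<tau> \<longleftrightarrow> range (fst \<tau>) \<subseteq> symbols \<and>
     (\<forall>n. fst \<tau> (snd \<tau> + int n) = nth_default Blank xs n)"

lemma stack_on_tape_word_tape: "set u \<subseteq> symbols \<Longrightarrow> stack_on_tape u (word_tape u)"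
  by (force simp: stack_on_tape_def word_tape_def nth_default_def symbols_def)

lemma stack_on_tape_read: "stack_on_tape xs (t, h) \<Longrightarrow> t h = peek xs"
  by (auto simp: stack_on_tape_def peek_def dest: spec[of _ 0])

lemma stack_on_tape_stay:
  assumes "stack_on_tape xs \<tau>"
  shows "stack_on_tape xs (act (peek xs, Stay) \<tau>)"
proof -
  obtain t h where \<tau>: "\<tau> = (t, h)" by fastforce
  then have "t(h := peek xs) = t" using stack_on_tape_read[of xs t h] assms by auto
  then show ?thesis using assms by (simp add: \<tau>)
qed

lemma stack_on_tape_pop:
  assumes "stack_on_tape xs \<tau>"
  shows "stack_on_tape (tl xs) (act (peek xs, MRight) \<tau>)"
proof -
  obtain t h where \<tau>: "\<tau> = (t, h)" by fastforce
  have "t (h + 1 + int n) = nth_default Blank (tl xs) n" for n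
    using assms[unfolded stack_on_tape_def, THEN conjunct2, rule_format, of "Suc n"]
    by (cases xs) (simp_all add: \<tau> add.assoc)
  moreover have "t(h := peek xs) = t" using stack_on_tape_read[of xs t h] assms \<tau> by auto
  ultimately show ?thesis using assms by (simp add: stack_on_tape_def \<tau>)
qed

lemma stack_on_tape_left:
  assumes "stack_on_tape xs \<tau>"
  obtains a where "stack_on_tape (a # xs) (act (peek xs, MLeft) \<tau>)"
proof -
  obtain t h where \<tau>: "\<tau> = (t, h)" by fastforce
  have "t (h - 1 + int n) = nth_default Blank (t (h - 1) # xs) n" for n
  proof (cases n)
    case (Suc m)
    then have "h - 1 + int n = h + int m" by simp
    then show ?thesis using assms by (simp add: stack_on_tape_def \<tau> Suc)
  qed simp
  moreover have "t(h := peek xs) = t" using stack_on_tape_read[of xs t h] assms \<tau> by auto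
  ultimately show thesis
    using assms by (intro that[of "t (h - 1)"]) (simp add: stack_on_tape_def \<tau>)
qed

lemma stack_on_tape_write:
  assumes "stack_on_tape (a # xs) \<tau>" "s \<in> symbols"
  shows "stack_on_tape (s # xs) (act (s, Stay) \<tau>)"
proof -
  obtain t h where \<tau>: "\<tau> = (t, h)" by fastforce
  have "(t(h := s)) (h + int n) = nth_default Blank (s # xs) n" for n
    using assms(1)[unfolded stack_on_tape_def, THEN conjunct2, rule_format, of n]
    by (cases n) (simp_all add: \<tau>)
  then show ?thesis using assms by (auto simp: stack_on_tape_def \<tau>)
qed

lemma tape_output_stack_on_tape:
  assumes "stack_on_tape v \<tau>" "Blank \<notin> set v"
  shows "tape_output \<tau> v"
  using assms by (auto simp: tape_output_def stack_on_tape_def nth_default_def split: prod.split)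

fun wf_com :: "'i set \<Rightarrow> 'i com \<Rightarrow> bool" where
  "wf_com I Skip \<longleftrightarrow> True"
| "wf_com I (Pop i) \<longleftrightarrow> i \<in> I"
| "wf_com I (Push i s) \<longleftrightarrow> i \<in> I \<and> s \<in> symbols"
| "wf_com I (Move i j) \<longleftrightarrow> i \<in> I \<and> j \<in> I"
| "wf_com I (Write i s) \<longleftrightarrow> i \<in> I \<and> s \<in> symbols"
| "wf_com I (p ;; q) \<longleftrightarrow> wf_com I p \<and> wf_com I q"
| "wf_com I (Cond i A p q) \<longleftrightarrow> wf_com I p \<and> wf_com I q"
| "wf_com I (While i A p) \<longleftrightarrow> wf_com I p"

fun expand :: "('i \<Rightarrow> sym) \<Rightarrow> 'i com \<Rightarrow> 'i com list" where
  "expand r (Push i s) = [Write i s]"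
| "expand r (Move i j) = [Write j (r i)]"
| "expand r (p ;; q) = [p, q]"
| "expand r (Cond i A p q) = [if r i \<in> A then p else q]"
| "expand r (While i A p) = (if r i \<in> A then [p, While i A p] else [])"
| "expand r _ = []"

fun action :: "('i \<Rightarrow> sym) \<Rightarrow> 'i com \<Rightarrow> 'i \<Rightarrow> sym \<times> move" where
  "action r (Pop i) k = (r k, if k = i then MRight else Stay)"
| "action r (Push i s) k = (r k, if k = i then MLeft else Stay)"
| "action r (Move i j) k = (r k, if k = i then MRight else if k = j then MLeft else Stay)"
| "action r (Write i s) k = (if k = i then s else r k, Stay)"
| "action r _ k = (r k, Stay)"

text \<open>The control states of the machine: the lists of commands still to be executed that can arise
  from \<open>p # cs\<close> before \<open>p\<close> is finished.\<close>

fun control_stacks :: "'i com \<Rightarrow> 'i com list \<Rightarrow> 'i com list set" where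
  "control_stacks (Push i s) cs = {Push i s # cs, Write i s # cs}"
| "control_stacks (Move i j) cs = insert (Move i j # cs) ((\<lambda>s. Write j s # cs) ` symbols)"
| "control_stacks (p ;; q) cs =
     insert ((p ;; q) # cs) (control_stacks p (q # cs) \<union> control_stacks q cs)"
| "control_stacks (Cond i A p q) cs =
     insert (Cond i A p q # cs) (control_stacks p cs \<union> control_stacks q cs)"
| "control_stacks (While i A p) cs =
     insert (While i A p # cs) (control_stacks p (While i A p # cs))"
| "control_stacks p cs = {p # cs}"

lemma finite_control_stacks: "finite (control_stacks p cs)"
  by (induction p cs rule: control_stacks.induct) (simp_all add: symbols_def)

lemma Cons_in_control_stacks [simp, intro]: "p # cs \<in> control_stacks p cs"
  by (cases p) auto

lemma control_stacks_closed:
  assumes "c # ds \<in> control_stacks p cs" "range r \<subseteq> symbols"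
  shows "expand r c @ ds \<in> insert cs (control_stacks p cs)"
proof -
  have "r i \<in> symbols" for i using assms(2) by auto
  with assms(1) show ?thesis
    by (induction p cs rule: control_stacks.induct) (auto split: if_splits)
qed

lemma wf_com_control_stacks:
  assumes "c # ds \<in> control_stacks p cs" "wf_com I p"
  shows "wf_com I c"
  using assms by (induction p cs rule: control_stacks.induct) auto

lemma fst_action_in_symbols:
  assumes "wf_com I c" "range r \<subseteq> symbols"
  shows "fst (action r c k) \<in> symbols"
  using assms by (cases c) auto

locale compiled_program =
  fixes names :: "'i list" and p :: "'i com" and code :: "'i com list \<Rightarrow> nat"
  assumes names_nonempty: "names \<noteq> []" and distinct_names: "distinct names"
    and wf: "wf_com (set names) p"
    and inj_code: "inj_on code (insert [] (control_stacks p []))"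
begin

definition controls :: "'i com list set" where
  "controls = insert [] (control_stacks p [])"

definition current :: "'i com list \<Rightarrow> 'i com" where
  "current cs = (case cs of [] \<Rightarrow> Skip | c # _ \<Rightarrow> c)"

definition reads :: "sym list \<Rightarrow> 'i \<Rightarrow> sym" where
  "reads as i = (case map_of (zip names as) i of None \<Rightarrow> Blank | Some a \<Rightarrow> a)"

definition machine :: tm where
  "machine =
     \<lparr>tapes = length names, states = code ` controls, alphabet = symbols,
      start = code [p], halt = code [],
      delta = (\<lambda>q as. let cs = inv_into controls code q; r = reads as in
        (code (expand r (current cs) @ tl cs), map (action r (current cs)) names))\<rparr>"

lemma machine_simps [simp]:
  "tapes machine = length names" "states machine = code ` controls" "alphabet machine = symbols"
  "start machine = code [p]" "halt machine = code []"
  by (simp_all add: machine_def)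

lemma delta_machine:
  assumes "cs \<in> controls"
  shows "delta machine (code cs) as =
    (code (expand (reads as) (current cs) @ tl cs), map (action (reads as) (current cs)) names)"
  using inv_into_f_f[OF inj_code, folded controls_def, OF assms] by (simp add: machine_def Let_def)

lemma wf_tm_machine: "wf_tm machine"
proof -
  have delta: "case delta machine q as of (q', acts) \<Rightarrow>
      q' \<in> states machine \<and> length acts = tapes machine \<and> fst ` set acts \<subseteq> alphabet machine"
    if q: "q \<in> states machine" and as: "set as \<subseteq> alphabet machine" for q as
  proof -
    obtain cs where cs: "cs \<in> controls" "q = code cs" using q by auto
    have "reads as i \<in> symbols" for i
    proof (cases "map_of (zip names as) i")
      case (Some a)
      then have "a \<in> set as" by (meson map_of_SomeD set_zip_rightD)
      then show ?thesis using as Some by (auto simp: reads_def)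
    qed (simp add: reads_def symbols_def)
    then have reads: "range (reads as) \<subseteq> symbols" by auto
    have "expand (reads as) (current cs) @ tl cs \<in> controls"
    proof (cases cs)
      case (Cons c ds)
      then show ?thesis
        using cs control_stacks_closed[OF _ reads, of c ds p "[]"]
        by (simp add: controls_def current_def)
    qed (simp add: controls_def current_def)
    moreover have "wf_com (set names) (current cs)"
    proof (cases cs)
      case (Cons c ds)
      then show ?thesis
        using cs wf_com_control_stacks[OF _ wf, of c ds "[]"]
        by (simp add: controls_def current_def)
    qed (simp add: current_def)
    then have "fst (action (reads as) (current cs) i) \<in> symbols" for i
      by (rule fst_action_in_symbols[OF _ reads])
    ultimately show ?thesis unfolding cs(2) delta_machine[OF cs(1)] by auto
  qed
  have "finite (states machine)" "code [p] \<in> states machine" "code [] \<in> states machine"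
    by (auto simp: controls_def finite_control_stacks)
  then show ?thesis
    unfolding wf_tm_def using delta names_nonempty by (simp add: symbols_def Suc_le_eq)
qed

text \<open>The tape list of a configuration is \<open>map T names\<close>.\<close>

definition represents :: "'i store \<Rightarrow> ('i \<Rightarrow> tape) \<Rightarrow> bool" where
  "represents \<sigma> T \<longleftrightarrow> (\<forall>i. stack_on_tape (\<sigma> i) (T i)) \<and> (\<forall>i. i \<notin> set names \<longrightarrow> \<sigma> i = [])"

definition tops :: "'i store \<Rightarrow> 'i \<Rightarrow> sym" where
  "tops \<sigma> i = peek (\<sigma> i)"

definition advance :: "'i com \<Rightarrow> 'i store \<Rightarrow> ('i \<Rightarrow> tape) \<Rightarrow> 'i \<Rightarrow> tape" where
  "advance c \<sigma> T i = act (action (tops \<sigma>) c i) (T i)"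

lemma read_tops:
  assumes "represents \<sigma> T"
  shows "fst (T i) (snd (T i)) = tops \<sigma> i"
  using assms stack_on_tape_read[of "\<sigma> i" "fst (T i)" "snd (T i)"]
  by (simp add: represents_def tops_def)

lemma reads_represents:
  assumes "represents \<sigma> T"
  shows "reads (map (\<lambda>(t, h). t h) (map T names)) = tops \<sigma>"
proof
  fix i
  show "reads (map (\<lambda>(t, h). t h) (map T names)) i = tops \<sigma> i"
    using assms read_tops[OF assms]
    by (cases "i \<in> set names")
      (simp_all add: reads_def represents_def tops_def map_of_zip_map case_prod_unfold)
qed

lemma tops_in_symbols:
  assumes "represents \<sigma> T"
  shows "tops \<sigma> i \<in> symbols"
proof -
  have "range (fst (T i)) \<subseteq> symbols" using assms by (simp add: represents_def stack_on_tape_def)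
  then show ?thesis by (metis range_subsetD read_tops[OF assms])
qed

lemma step_machine:
  assumes "c # cs \<in> controls" "represents \<sigma> T"
  shows "step machine (code (c # cs), map T names) =
    (code (expand (tops \<sigma>) c @ cs), map (advance c \<sigma> T) names)"
proof -
  have "code (c # cs) \<noteq> code []"
    using inj_code assms(1) unfolding controls_def inj_on_def by blast
  then show ?thesis
    using delta_machine[OF assms(1)] reads_represents[OF assms(2)]
    by (simp add: current_def advance_def map2_map_map)
qed

definition runs :: "'i com list \<Rightarrow> 'i store \<Rightarrow> nat \<Rightarrow> 'i com list \<Rightarrow> 'i store \<Rightarrow> bool" where
  "runs cs \<sigma> t cs' \<sigma>' \<longleftrightarrow> (\<forall>T. represents \<sigma> T \<longrightarrow> (\<exists>u\<le>t. \<exists>T'. represents \<sigma>' T' \<and>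
     (step machine ^^ u) (code cs, map T names) = (code cs', map T' names)))"

lemma runs_refl: "runs cs \<sigma> 0 cs \<sigma>"
  by (auto simp: runs_def)

lemma runs_mono: "runs cs \<sigma> t cs' \<sigma>' \<Longrightarrow> t \<le> u \<Longrightarrow> runs cs \<sigma> u cs' \<sigma>'"
  unfolding runs_def by (meson order_trans)

lemma runs_trans:
  assumes "runs cs \<sigma> t cs' \<sigma>'" "runs cs' \<sigma>' u cs'' \<sigma>''"
  shows "runs cs \<sigma> (t + u) cs'' \<sigma>''"
  unfolding runs_def
proof (intro allI impI)
  fix T assume "represents \<sigma> T"
  then obtain m T' where m: "m \<le> t" and T': "represents \<sigma>' T'"
    and first: "(step machine ^^ m) (code cs, map T names) = (code cs', map T' names)"
    using assms(1) unfolding runs_def by blast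
  then obtain n T'' where n: "n \<le> u" and T'': "represents \<sigma>'' T''"
    and second: "(step machine ^^ n) (code cs', map T' names) = (code cs'', map T'' names)"
    using assms(2) unfolding runs_def by blast
  have "(step machine ^^ (n + m)) (code cs, map T names) = (code cs'', map T'' names)"
    unfolding funpow_add o_apply first second ..
  then show "\<exists>v\<le>t + u. \<exists>T''. represents \<sigma>'' T'' \<and>
      (step machine ^^ v) (code cs, map T names) = (code cs'', map T'' names)"
    using m n T'' by (intro exI[of _ "n + m"]) auto
qed

lemma runs_step:
  assumes "c # cs \<in> controls" "\<And>T. represents \<sigma> T \<Longrightarrow> represents \<sigma>' (advance c \<sigma> T)"
  shows "runs (c # cs) \<sigma> 1 (expand (tops \<sigma>) c @ cs) \<sigma>'"
  unfolding runs_def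
proof (intro allI impI)
  fix T assume "represents \<sigma> T"
  then show "\<exists>u\<le>1. \<exists>T'. represents \<sigma>' T' \<and> (step machine ^^ u) (code (c # cs), map T names) =
      (code (expand (tops \<sigma>) c @ cs), map T' names)"
    using assms(2) step_machine[OF assms(1)] by (intro exI[of _ 1]) (auto simp del: step.simps)
qed

lemma runs_control:
  assumes "c # cs \<in> controls" "\<And>r i. action r c i = (r i, Stay)"
    and "runs (expand (tops \<sigma>) c @ cs) \<sigma> t cs' \<sigma>'"
  shows "runs (c # cs) \<sigma> (t + 1) cs' \<sigma>'"
proof -
  have "represents \<sigma> (advance c \<sigma> T)" if "represents \<sigma> T" for T
    using that assms(2) stack_on_tape_stay
    by (simp add: represents_def advance_def tops_def del: act.simps)
  then have "runs (c # cs) \<sigma> (1 + t) cs' \<sigma>'"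
    using runs_step[OF assms(1)] assms(3) by (blast intro: runs_trans)
  then show ?thesis by simp
qed

text \<open>A move to the left uncovers some symbol \<open>a\<close>, which is overwritten in the next step.\<close>

lemma runs_left_Write:
  assumes cs: "c # cs \<in> controls" "s \<in> symbols \<Longrightarrow> Write i s # cs \<in> controls"
    and i: "i \<in> set names" and s: "\<And>T. represents \<sigma> T \<Longrightarrow> s \<in> symbols"
    and expand: "expand (tops \<sigma>) c = [Write i s]"
    and left: "\<And>T. represents \<sigma> T \<Longrightarrow> \<exists>a. represents (\<sigma>'(i := a # \<sigma>' i)) (advance c \<sigma> T)"
  shows "runs (c # cs) \<sigma> 2 cs (\<sigma>'(i := s # \<sigma>' i))"
  unfolding runs_def
proof (intro allI impI)
  fix T assume T: "represents \<sigma> T"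
  define T' where "T' = advance c \<sigma> T"
  obtain a where T': "represents (\<sigma>'(i := a # \<sigma>' i)) T'" using left[OF T] T'_def by blast
  define T'' where "T'' = advance (Write i s) (\<sigma>'(i := a # \<sigma>' i)) T'"
  have "stack_on_tape (a # \<sigma>' i) (T' i)" "\<And>k. k \<noteq> i \<Longrightarrow> stack_on_tape (\<sigma>' k) (T' k)"
    using T' unfolding represents_def by (metis fun_upd_same, metis fun_upd_other)
  then have "stack_on_tape ((\<sigma>'(i := s # \<sigma>' i)) k) (T'' k)" for k
    using stack_on_tape_stay stack_on_tape_write s[OF T]
    by (simp add: T''_def advance_def tops_def del: act.simps)
  moreover have "(\<sigma>'(i := s # \<sigma>' i)) k = []" if "k \<notin> set names" for k
    using T' that i by (auto simp: represents_def split: if_splits)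
  ultimately have T'': "represents (\<sigma>'(i := s # \<sigma>' i)) T''" by (simp add: represents_def)
  have "step machine (code (c # cs), map T names) = (code (Write i s # cs), map T' names)"
    using step_machine[OF cs(1) T] expand by (simp add: T'_def)
  moreover have "step machine (code (Write i s # cs), map T' names) = (code cs, map T'' names)"
    using step_machine[OF cs(2)[OF s[OF T]] T'] by (simp add: T''_def)
  ultimately have "(step machine ^^ 2) (code (c # cs), map T names) = (code cs, map T'' names)"
    by (simp add: numeral_2_eq_2 del: step.simps)
  then show "\<exists>u\<le>2. \<exists>T'. represents (\<sigma>'(i := s # \<sigma>' i)) T' \<and>
      (step machine ^^ u) (code (c # cs), map T names) = (code cs, map T' names)"
    using T'' by (intro exI[of _ 2]) blast
qed

lemma runs_Pop:
  assumes "Pop i # cs \<in> controls" "i \<in> set names"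
  shows "runs (Pop i # cs) \<sigma> 1 cs (\<sigma>(i := tl (\<sigma> i)))"
proof -
  have "represents (\<sigma>(i := tl (\<sigma> i))) (advance (Pop i) \<sigma> T)" if "represents \<sigma> T" for T
    using that assms(2) stack_on_tape_stay stack_on_tape_pop
    by (auto simp: represents_def advance_def tops_def simp del: act.simps)
  then show ?thesis using runs_step[OF assms(1)] by simp
qed

lemma runs_Push:
  assumes "Push i s # cs \<in> controls" "Write i s # cs \<in> controls" "i \<in> set names" "s \<in> symbols"
  shows "runs (Push i s # cs) \<sigma> 2 cs (\<sigma>(i := s # \<sigma> i))"
proof (rule runs_left_Write)
  fix T assume T: "represents \<sigma> T"
  obtain a where "stack_on_tape (a # \<sigma> i) (act (peek (\<sigma> i), MLeft) (T i))"
    using T stack_on_tape_left unfolding represents_def by blast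
  then show "\<exists>a. represents (\<sigma>(i := a # \<sigma> i)) (advance (Push i s) \<sigma> T)"
    using T assms(3) stack_on_tape_stay
    by (intro exI[of _ a]) (auto simp: represents_def advance_def tops_def simp del: act.simps)
qed (use assms in simp_all)

lemma runs_Move:
  assumes "Move i j # cs \<in> controls" "\<And>s. s \<in> symbols \<Longrightarrow> Write j s # cs \<in> controls"
    and "i \<in> set names" "j \<in> set names" "i \<noteq> j"
  shows "runs (Move i j # cs) \<sigma> 2 cs (\<sigma>(i := tl (\<sigma> i), j := peek (\<sigma> i) # \<sigma> j))"
proof -
  let ?\<sigma> = "\<sigma>(i := tl (\<sigma> i))"
  have "runs (Move i j # cs) \<sigma> 2 cs (?\<sigma>(j := tops \<sigma> i # ?\<sigma> j))"
  proof (rule runs_left_Write)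
    fix T assume T: "represents \<sigma> T"
    obtain a where "stack_on_tape (a # \<sigma> j) (act (peek (\<sigma> j), MLeft) (T j))"
      using T stack_on_tape_left unfolding represents_def by blast
    then show "\<exists>a. represents (?\<sigma>(j := a # ?\<sigma> j)) (advance (Move i j) \<sigma> T)"
      using T assms(3-5) stack_on_tape_stay stack_on_tape_pop
      by (intro exI[of _ a]) (auto simp: represents_def advance_def tops_def simp del: act.simps)
  qed (use assms tops_in_symbols in auto)
  then show ?thesis using assms(5) by (simp add: tops_def fun_upd_other del: fun_upd_apply)
qed

lemma runs_exec:
  assumes "exec c \<sigma> t \<sigma>'" "control_stacks c cs \<subseteq> controls" "cs \<in> controls" "wf_com (set names) c"
  shows "runs (c # cs) \<sigma> t cs \<sigma>'"
  using assms
proof (induction arbitrary: cs)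
  case (Skip \<sigma>)
  then show ?case using runs_control[of Skip cs \<sigma> 0] runs_refl by simp
next
  case (Pop i \<sigma>)
  then show ?case by (intro runs_Pop) auto
next
  case (Push i s \<sigma>)
  then show ?case by (intro runs_Push) auto
next
  case (Move i j \<sigma>)
  then show ?case by (intro runs_Move) auto
next
  case (Seq p \<sigma> t \<sigma>' q u \<sigma>'')
  then have "q # cs \<in> controls" by auto
  then have "runs (p # q # cs) \<sigma> t (q # cs) \<sigma>'" "runs (q # cs) \<sigma>' u cs \<sigma>''"
    using Seq.IH Seq.prems by auto
  then have "runs (p # q # cs) \<sigma> (t + u) cs \<sigma>''" by (rule runs_trans)
  then show ?case using Seq.prems by (intro runs_control) auto
next
  case (Cond_True \<sigma> i A p t \<sigma>' q)
  then show ?case by (intro runs_control) (auto simp: tops_def)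
next
  case (Cond_False \<sigma> i A q t \<sigma>' p)
  then show ?case by (intro runs_control) (auto simp: tops_def)
next
  case (While_False \<sigma> i A p)
  then show ?case using runs_control[of "While i A p" cs \<sigma> 0] runs_refl by (simp add: tops_def)
next
  case (While_True \<sigma> i A p t \<sigma>' u \<sigma>'')
  then have "While i A p # cs \<in> controls" by auto
  then have "runs (p # While i A p # cs) \<sigma> t (While i A p # cs) \<sigma>'"
    "runs (While i A p # cs) \<sigma>' u cs \<sigma>''"
    using While_True.IH While_True.prems by auto
  then have "runs (p # While i A p # cs) \<sigma> (t + u) cs \<sigma>''" by (rule runs_trans)
  then show ?case using While_True by (intro runs_control) (auto simp: tops_def)
next
  case (weaken c \<sigma> t \<sigma>' u)
  then show ?case using runs_mono by blast
qed

lemma init_config_machine: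
  "init_config machine u =
     (code [p], map (\<lambda>i. word_tape (if i = hd names then u else [])) names)"
proof (cases names)
  case (Cons i ks)
  then have "map (\<lambda>k. word_tape (if k = i then u else [])) ks = map (\<lambda>_. word_tape []) ks"
    using distinct_names Cons by (intro map_cong) auto
  then show ?thesis by (simp add: init_config_def map_replicate_const) (simp add: Cons)
qed (use names_nonempty in simp)

lemma computes_within_machine:
  assumes "exec p ((\<lambda>_. [])(hd names := u)) t \<sigma>'" "set u \<subseteq> symbols" "Blank \<notin> set (\<sigma>' (hd names))"
  shows "computes_within machine u (\<sigma>' (hd names)) t"
proof -
  let ?\<sigma> = "(\<lambda>_. [])(hd names := u)"
  let ?T = "\<lambda>i. word_tape (if i = hd names then u else [])"
  have "runs [p] ?\<sigma> t [] \<sigma>'"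
    using runs_exec[OF assms(1), of "[]"] wf by (auto simp: controls_def)
  moreover have "represents ?\<sigma> ?T"
    using assms(2) names_nonempty by (auto simp: represents_def stack_on_tape_word_tape)
  ultimately obtain m T where m: "m \<le> t" and T: "represents \<sigma>' T"
    and run: "(step machine ^^ m) (init_config machine u) = (code [], map T names)"
    unfolding runs_def init_config_machine by blast
  have "(step machine ^^ n) (code [], ts) = (code [], ts)" for n ts
    by (induction n) simp_all
  then have "(step machine ^^ t) (init_config machine u) = (code [], map T names)"
    using m run funpow_add[of "t - m" m "step machine"] by (simp del: step.simps)
  moreover have "tape_output (map T names ! 0) (\<sigma>' (hd names))"
    using T assms(3) names_nonempty tape_output_stack_on_tape
    by (simp add: represents_def hd_conv_nth)
  ultimately show ?thesis by (simp add: computes_within_def)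
qed

end

theorem polytime_computable_exec:
  fixes b :: "nat poly"
  assumes names: "distinct (i # names)" and wf: "wf_com (set (i # names)) p"
    and run: "\<And>x. x \<in> D \<Longrightarrow> \<exists>\<sigma>'. exec p ((\<lambda>_. [])(i := enc_in x)) (poly b (length (enc_in x))) \<sigma>' \<and>
      \<sigma>' i = enc_out (f x)"
    and symbols: "\<And>x. x \<in> D \<Longrightarrow> set (enc_in x) \<subseteq> symbols"
    and no_blank: "\<And>x. x \<in> D \<Longrightarrow> Blank \<notin> set (enc_out (f x))"
  shows "polytime_computable D enc_in enc_out f"
proof -
  have fin: "finite (insert [] (control_stacks p []))" by (simp add: finite_control_stacks)
  obtain code :: "_ \<Rightarrow> nat" where "inj_on code (insert [] (control_stacks p []))"
    using finite_imp_inj_to_nat_seg[OF fin] by (elim exE conjE)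
  then interpret compiled_program "i # names" p code
    using names wf by unfold_locales auto
  have "computes_within machine (enc_in x) (enc_out (f x)) (poly b (length (enc_in x)))"
    if "x \<in> D" for x
    using run[OF that] symbols[OF that] no_blank[OF that] computes_within_machine by fastforce
  then show ?thesis
    unfolding polytime_computable_def using wf_tm_machine
    by (intro exI[of _ machine] exI[of _ b]) simp
qed

section \<open>Loops\<close>

text \<open>Stores are compared as chains of updates; expanding these into conditionals would leave terms
  that no longer match the rules of \<^const>\<open>exec\<close>.\<close>

declare fun_upd_apply [simp del] fun_upd_same [simp] fun_upd_other [simp]

text \<open>\<open>S ds ys\<close> is the store once \<open>ds\<close> has been processed and \<open>ys\<close> remains.\<close>

lemma exec_While_list:
  assumes enter: "\<And>ds x ys. xs = ds @ x # ys \<Longrightarrow> peek (S ds (x # ys) i) \<in> A"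
    and exit: "peek (S xs [] i) \<notin> A"
    and body: "\<And>ds x ys. xs = ds @ x # ys \<Longrightarrow> exec p (S ds (x # ys)) t (S (ds @ [x]) ys)"
  shows "exec (While i A p) (S [] xs) (length xs * (t + 1) + 1) (S xs [])"
proof -
  have "exec (While i A p) (S ds ys) (length ys * (t + 1) + 1) (S xs [])"
    if "xs = ds @ ys" for ds ys
    using that
  proof (induction ys arbitrary: ds)
    case Nil
    then show ?case using exit exec.While_False[of "S xs []" i A p] by simp
  next
    case (Cons y ys)
    have "exec (While i A p) (S ds (y # ys)) (t + (length ys * (t + 1) + 1) + 1) (S xs [])"
      using enter[OF Cons.prems] body[OF Cons.prems] Cons.IH[of "ds @ [y]"] Cons.prems
      by (intro exec.While_True) auto
    then show ?case by (simp add: algebra_simps)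
  qed
  from this[of "[]" xs] show ?thesis by simp
qed

definition move_while :: "'i \<Rightarrow> sym set \<Rightarrow> 'i \<Rightarrow> 'i com" where
  "move_while i A j = While i A (Move i j)"

lemma exec_move_while:
  assumes "i \<noteq> j" "\<sigma> i = xs @ ys" "set xs \<subseteq> A" "peek ys \<notin> A"
  shows "exec (move_while i A j) \<sigma> (3 * length xs + 1) (\<sigma>(i := ys, j := rev xs @ \<sigma> j))"
proof -
  define S where "S ds zs = \<sigma>(i := zs @ ys, j := rev ds @ \<sigma> j)" for ds zs
  have body: "exec (Move i j) (S ds (x # zs)) 2 (S (ds @ [x]) zs)" for ds x zs
    using exec.Move[OF assms(1), of "S ds (x # zs)"] assms(1)
    by (simp add: S_def fun_upd_twist)
  have "exec (While i A (Move i j)) (S [] xs) (length xs * (2 + 1) + 1) (S xs [])"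
    by (rule exec_While_list[where S = S, OF _ _ body]) (use assms in \<open>auto simp: S_def\<close>)
  moreover have "S [] xs = \<sigma>" using assms by (simp add: S_def fun_upd_idem)
  ultimately show ?thesis by (simp add: S_def move_while_def mult.commute)
qed

definition pop_while :: "'i \<Rightarrow> sym set \<Rightarrow> 'i com" where
  "pop_while i A = While i A (Pop i)"

lemma exec_pop_while:
  assumes "\<sigma> i = xs @ ys" "set xs \<subseteq> A" "peek ys \<notin> A"
  shows "exec (pop_while i A) \<sigma> (2 * length xs + 1) (\<sigma>(i := ys))"
proof -
  define S where "S ds zs = \<sigma>(i := zs @ ys)" for ds zs :: "sym list"
  have body: "exec (Pop i) (S ds (x # zs)) 1 (S (ds @ [x]) zs)" for ds x zs
    using exec.Pop[of i "S ds (x # zs)"] by (simp add: S_def)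
  have "exec (While i A (Pop i)) (S [] xs) (length xs * (1 + 1) + 1) (S xs [])"
    by (rule exec_While_list[where S = S, OF _ _ body]) (use assms in \<open>auto simp: S_def\<close>)
  moreover have "S [] xs = \<sigma>" using assms(1) by (simp add: S_def fun_upd_idem)
  ultimately show ?thesis by (simp add: S_def pop_while_def mult_2 mult_2_right)
qed

section \<open>Encodings\<close>

lemma enc_set_lessThan: "enc_set n {..<n} = replicate n One"
  by (auto simp: enc_set_def list_eq_iff_nth_eq)

lemma length_enc_set [simp]: "length (enc_set n U) = n"
  by (simp add: enc_set_def)

lemma set_enc_set: "set (enc_set n U) \<subseteq> {Zero, One}"
  by (auto simp: enc_set_def)

lemma enc_classes_simps [simp]:
  "enc_classes n [] = []" "enc_classes n (U # Us) = Comma # enc_set n U @ enc_classes n Us"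
  by (simp_all add: enc_classes_def)

lemma length_enc_classes: "length (enc_classes n Us) = length Us * (n + 1)"
  by (induction Us) auto

lemma set_enc_classes: "set (enc_classes n Us) \<subseteq> {Zero, One, Comma}"
  using set_enc_set by (induction Us) fastforce+

lemma set_enc_pm_triple: "set (enc_pm_triple x) \<subseteq> {Zero, One, Comma, Semicolon}"
proof -
  obtain n Us1 Us2 Us3 where "x = (n, Us1, Us2, Us3)" by (cases x)
  then show ?thesis
    using set_enc_set[of n "{..<n}"] set_enc_classes[of n Us1] set_enc_classes[of n Us2]
      set_enc_classes[of n Us3]
    by auto
qed

section \<open>Writing a perfect matching\<close>

datatype graph_stack = Word | Before | After | Aux

primrec push_word :: "'i \<Rightarrow> sym list \<Rightarrow> 'i com" where
  "push_word i [] = Skip"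
| "push_word i (x # xs) = push_word i xs ;; Push i x"

lemma exec_push_word: "exec (push_word i w) \<sigma> (3 * length w + 1) (\<sigma>(i := w @ \<sigma> i))"
proof (induction w)
  case Nil
  show ?case using exec.Skip[of \<sigma>] by simp
next
  case (Cons x w)
  show ?case using exec.Seq[OF Cons.IH exec.Push[of i x]] by (simp add: eval_nat_numeral)
qed

definition repeat :: "'i \<Rightarrow> 'i \<Rightarrow> 'i com \<Rightarrow> 'i com" where
  "repeat i j p = While i {One} (Move i j ;; p) ;; move_while j {One} i"

lemma exec_repeat:
  assumes distinct: "i \<noteq> j" "i \<noteq> k" "j \<noteq> k" and \<sigma>: "\<sigma> i = replicate m One" "\<sigma> j = []"
    and p: "\<And>\<sigma>. exec p \<sigma> t (\<sigma>(k := w @ \<sigma> k))"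
  shows "exec (repeat i j p) \<sigma> (m * (t + 7) + 3) (\<sigma>(k := concat (replicate m w) @ \<sigma> k))"
proof -
  define S :: "nat list \<Rightarrow> nat list \<Rightarrow> _" where
    "S ds xs = \<sigma>(i := replicate (length xs) One, j := replicate (length ds) One,
       k := concat (replicate (length ds) w) @ \<sigma> k)" for ds xs
  have body: "exec (Move i j ;; p) (S ds (x # xs)) (2 + t + 1) (S (ds @ [x]) xs)" for ds x xs
    using exec.Seq[OF exec.Move[OF distinct(1)] p, of "S ds (x # xs)"] distinct
    by (simp add: S_def fun_upd_twist)
  have "exec (While i {One} (Move i j ;; p)) (S [] [0..<m]) (length [0..<m] * (2 + t + 1 + 1) + 1)
      (S [0..<m] [])"
    by (rule exec_While_list[where S = S, OF _ _ body]) (use distinct in \<open>auto simp: S_def\<close>)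
  moreover have "S [] [0..<m] = \<sigma>" using \<sigma> distinct by (simp add: S_def fun_upd_idem)
  moreover have "exec (move_while j {One} i) (S [0..<m] []) (3 * length (replicate m One) + 1)
      ((S [0..<m] [])(j := [], i := rev (replicate m One) @ S [0..<m] [] i))"
    using distinct by (intro exec_move_while) (auto simp: S_def)
  moreover have "(S [0..<m] [])(j := [], i := rev (replicate m One) @ S [0..<m] [] i) =
      \<sigma>(k := concat (replicate m w) @ \<sigma> k)"
    using distinct \<sigma> by (auto simp: S_def fun_eq_iff fun_upd_apply)
  ultimately have "exec (repeat i j p) \<sigma> (m * (2 + t + 1 + 1) + 1 + (3 * m + 1) + 1)
      (\<sigma>(k := concat (replicate m w) @ \<sigma> k))"
    unfolding repeat_def using exec.Seq by fastforce
  then show ?thesis by (rule exec.weaken) (simp add: algebra_simps)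
qed

definition edge_word :: "nat \<Rightarrow> nat \<Rightarrow> sym list" where
  "edge_word a b = Semicolon # replicate (2 * a) Zero @ [One, One] @ replicate (2 * b) Zero @
     [Comma, One, Slash, One]"

definition push_edge :: "graph_stack com" where
  "push_edge = push_word Word [Comma, One, Slash, One] ;;
     repeat After Aux (push_word Word [Zero, Zero]) ;; push_word Word [One, One] ;;
     repeat Before Aux (push_word Word [Zero, Zero]) ;; Push Word Semicolon"

lemma concat_replicate_pair: "concat (replicate m [x, x]) = replicate (2 * m) x"
  by (induction m) simp_all

lemma exec_push_edge:
  assumes "\<sigma> Before = replicate a One" "\<sigma> After = replicate b One" "\<sigma> Aux = []"
  shows "exec push_edge \<sigma> (14 * (a + b) + 32) (\<sigma>(Word := edge_word a b @ \<sigma> Word))"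
proof -
  have zeros: "exec (repeat i Aux (push_word Word [Zero, Zero])) \<tau> (m * 14 + 3)
      (\<tau>(Word := replicate (2 * m) Zero @ \<tau> Word))"
    if "i \<in> {Before, After}" "\<tau> i = replicate m One" "\<tau> Aux = []" for i m \<tau>
    using exec_repeat[of i Aux Word \<tau> m _ 7 "[Zero, Zero]"] that
      exec_push_word[of Word "[Zero, Zero]"]
    by (auto simp: concat_replicate_pair)
  let ?W = "\<lambda>w. \<sigma>(Word := w @ \<sigma> Word)"
  let ?v = "[Comma, One, Slash, One]" and ?zeros = "\<lambda>m. replicate (2 * m) Zero"
  have "exec (push_word Word ?v) \<sigma> 13 (?W ?v)"
    using exec_push_word[of Word ?v \<sigma>] by simp
  moreover have "exec (repeat After Aux (push_word Word [Zero, Zero])) (?W ?v) (b * 14 + 3)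
      (?W (?zeros b @ ?v))"
    using zeros[of After "?W ?v" b] assms by simp
  moreover have "exec (push_word Word [One, One]) (?W (?zeros b @ ?v)) 7
      (?W ([One, One] @ ?zeros b @ ?v))"
    using exec_push_word[of Word "[One, One]" "?W (?zeros b @ ?v)"] by simp
  moreover have "exec (repeat Before Aux (push_word Word [Zero, Zero]))
      (?W ([One, One] @ ?zeros b @ ?v)) (a * 14 + 3) (?W (?zeros a @ [One, One] @ ?zeros b @ ?v))"
    using zeros[of Before "?W ([One, One] @ ?zeros b @ ?v)" a] assms by simp
  moreover have "exec (Push Word Semicolon) (?W (?zeros a @ [One, One] @ ?zeros b @ ?v)) 2
      (?W (edge_word a b))"
    using exec.Push[of Word Semicolon "?W (?zeros a @ [One, One] @ ?zeros b @ ?v)"]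
    by (simp add: edge_word_def)
  ultimately have "exec push_edge \<sigma> (13 + (b * 14 + 3 + (7 + (a * 14 + 3 + 2 + 1) + 1) + 1) + 1)
      (?W (edge_word a b))"
    unfolding push_edge_def by (intro exec.Seq)
  then show ?thesis by (rule exec.weaken) simp
qed

definition push_edges :: "graph_stack com" where
  "push_edges = While Before {One} (Pop Before ;; push_edge ;; Push After One)"

lemma exec_push_edges:
  assumes "\<sigma> Before = replicate m One" "\<sigma> After = replicate b One" "\<sigma> Aux = []"
  shows "exec push_edges \<sigma> (m * (14 * (m + b) + 38) + 1)
    (\<sigma>(Before := [], After := replicate (m + b) One,
       Word := concat (map (\<lambda>i. edge_word i (m + b - 1 - i)) [0..<m]) @ \<sigma> Word))"
  using assms
proof (induction m arbitrary: \<sigma> b)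
  case 0
  then have "\<sigma>(Before := [], After := replicate b One) = \<sigma>" by (auto simp: fun_upd_idem)
  then show ?case using 0 exec.While_False[of \<sigma> Before "{One}"] by (simp add: push_edges_def)
next
  case (Suc m)
  let ?\<sigma> = "\<sigma>(Before := replicate m One)"
  let ?\<sigma>' = "?\<sigma>(Word := edge_word m b @ \<sigma> Word)"
  let ?\<sigma>'' = "?\<sigma>'(After := replicate (Suc b) One)"
  have "exec (Pop Before) \<sigma> 1 ?\<sigma>" using exec.Pop[of Before \<sigma>] Suc.prems by simp
  moreover have "exec push_edge ?\<sigma> (14 * (m + b) + 32) ?\<sigma>'"
    using exec_push_edge[of ?\<sigma> m b] Suc.prems by simp
  moreover have "exec (Push After One) ?\<sigma>' 2 ?\<sigma>''"
    using exec.Push[of After One ?\<sigma>'] Suc.prems by simp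
  ultimately have body: "exec (Pop Before ;; push_edge ;; Push After One) \<sigma>
      (1 + (14 * (m + b) + 32 + 2 + 1) + 1) ?\<sigma>''"
    by (intro exec.Seq)
  have loop: "exec push_edges ?\<sigma>'' (m * (14 * (m + Suc b) + 38) + 1)
      (\<sigma>(Before := [], After := replicate (Suc m + b) One,
         Word := concat (map (\<lambda>i. edge_word i (Suc m + b - 1 - i)) [0..<Suc m]) @ \<sigma> Word))"
    using Suc.IH[of ?\<sigma>'' "Suc b"] Suc.prems by (simp add: fun_upd_twist)
  show ?case
    unfolding push_edges_def
    by (rule exec.weaken[OF exec.While_True[OF _ body loop[unfolded push_edges_def]]])
      (use Suc.prems in \<open>simp_all add: algebra_simps\<close>)
qed

lemma enc_rat_1: "enc_rat 1 = [One, Slash, One]"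
  by (simp add: enc_rat_def)

lemma enc_set_matching_edge:
  assumes "m < N"
  shows "enc_set (2 * N) {2 * m, 2 * m + 1} =
    replicate (2 * m) Zero @ [One, One] @ replicate (2 * (N - 1 - m)) Zero"
proof -
  have "[0..<2 * N] = [0..<2 * m] @ [2 * m, 2 * m + 1] @ [2 * m + 2..<2 * N]"
    using assms upt_add_eq_append[of 0 "2 * m" "2 * N - 2 * m"] by (simp add: upt_conv_Cons)
  moreover have "map f [2 * m + 2..<2 * N] = replicate (2 * (N - 1 - m)) Zero"
    if "\<And>i. i \<ge> 2 * m + 2 \<Longrightarrow> f i = Zero" for f
    using that by (auto simp: list_eq_iff_nth_eq)
  ultimately show ?thesis
    by (auto simp: enc_set_def list_eq_iff_nth_eq nth_append nth_Cons split: nat.split)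
qed

lemma enc_matching_graph:
  "enc_wgraph (matching_graph N) =
     replicate (2 * N) One @ concat (map (\<lambda>m. edge_word m (N - 1 - m)) [0..<N])"
  by (auto simp: matching_graph_def enc_set_lessThan enc_rat_1 edge_word_def enc_set_matching_edge
      simp del: One_nat_def intro!: arg_cong[of _ _ concat])

definition load_counter :: "graph_stack com" where
  "load_counter = While Word {One} (Move Word Before ;; Push Before One)"

lemma exec_load_counter:
  assumes "peek rest \<noteq> One"
  shows "exec load_counter ((\<lambda>_. [])(Word := replicate n One @ rest)) (6 * n + 1)
    ((\<lambda>_. [])(Word := rest, Before := replicate (2 * n) One))"
proof -
  define S :: "nat list \<Rightarrow> nat list \<Rightarrow> graph_stack store" where
    "S ds xs = (\<lambda>_. [])(Word := replicate (length xs) One @ rest,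
       Before := replicate (2 * length ds) One)" for ds xs
  have body: "exec (Move Word Before ;; Push Before One) (S ds (x # xs)) 5 (S (ds @ [x]) xs)"
    for ds x xs
    using exec.Seq[OF exec.Move[of Word Before "S ds (x # xs)"] exec.Push[of Before One]]
    by (simp add: S_def fun_upd_twist)
  have "exec load_counter (S [] [0..<n]) (length [0..<n] * (5 + 1) + 1) (S [0..<n] [])"
    unfolding load_counter_def
    by (rule exec_While_list[where S = S, OF _ _ body]) (use assms in \<open>auto simp: S_def\<close>)
  then show ?thesis by (simp add: S_def fun_upd_idem mult.commute)
qed

definition graph_com :: "graph_stack com" where
  "graph_com = load_counter ;; pop_while Word (- {Blank}) ;; push_edges ;;
     repeat After Aux (push_word Word [One, One])"

lemma exec_graph_com:
  fixes n :: nat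
  assumes rest: "peek rest \<noteq> One" "Blank \<notin> set rest"
  defines "L \<equiv> n + length rest"
  shows "exec graph_com ((\<lambda>_. [])(Word := replicate n One @ rest)) (poly [:9, 112, 56:] L)
    ((\<lambda>_. [])(After := replicate (2 * n) One, Word := enc_wgraph (matching_graph (2 * n))))"
proof -
  define \<sigma>\<^sub>1 \<sigma>\<^sub>2 \<sigma>\<^sub>3 :: "graph_stack store"
    where "\<sigma>\<^sub>1 = (\<lambda>_. [])(Word := rest, Before := replicate (2 * n) One)"
      and "\<sigma>\<^sub>2 = (\<lambda>_. [])(Before := replicate (2 * n) One)"
      and "\<sigma>\<^sub>3 = (\<lambda>_. [])(After := replicate (2 * n) One,
        Word := concat (map (\<lambda>m. edge_word m (2 * n - 1 - m)) [0..<2 * n]))"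
  note stores = \<sigma>\<^sub>1_def \<sigma>\<^sub>2_def \<sigma>\<^sub>3_def
  have "exec load_counter ((\<lambda>_. [])(Word := replicate n One @ rest)) (6 * n + 1) \<sigma>\<^sub>1"
    unfolding \<sigma>\<^sub>1_def by (rule exec_load_counter[OF rest(1)])
  moreover have "exec (pop_while Word (- {Blank})) \<sigma>\<^sub>1 (2 * length rest + 1) \<sigma>\<^sub>2"
    using exec_pop_while[of \<sigma>\<^sub>1 Word rest "[]" "- {Blank}"] rest(2)
    by (auto simp: stores fun_upd_twist[of Word] fun_upd_idem)
  moreover have "exec push_edges \<sigma>\<^sub>2 (2 * n * (14 * (2 * n) + 38) + 1) \<sigma>\<^sub>3"
    using exec_push_edges[of \<sigma>\<^sub>2 "2 * n" 0] by (simp add: stores fun_upd_idem)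
  moreover have "exec (repeat After Aux (push_word Word [One, One])) \<sigma>\<^sub>3 (2 * n * (7 + 7) + 3)
      (\<sigma>\<^sub>3(Word := concat (replicate (2 * n) [One, One]) @ \<sigma>\<^sub>3 Word))"
    by (rule exec_repeat) (use exec_push_word[of Word "[One, One]"] in \<open>simp_all add: stores\<close>)
  ultimately have "exec graph_com ((\<lambda>_. [])(Word := replicate n One @ rest))
      (6 * n + 1 + (2 * length rest + 1 +
        (2 * n * (14 * (2 * n) + 38) + 1 + (2 * n * (7 + 7) + 3) + 1) + 1) + 1)
      (\<sigma>\<^sub>3(Word := concat (replicate (2 * n) [One, One]) @ \<sigma>\<^sub>3 Word))"
    unfolding graph_com_def by (intro exec.Seq)
  also have "\<sigma>\<^sub>3(Word := concat (replicate (2 * n) [One, One]) @ \<sigma>\<^sub>3 Word) =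
      (\<lambda>_. [])(After := replicate (2 * n) One, Word := enc_wgraph (matching_graph (2 * n)))"
    by (simp add: stores concat_replicate_pair enc_matching_graph)
  finally show ?thesis by (rule exec.weaken) (simp add: L_def algebra_simps)
qed

lemma Blank_notin_matching_graph: "Blank \<notin> set (enc_wgraph (matching_graph N))"
  by (auto simp: enc_matching_graph edge_word_def)

lemma polytime_pairing_graph: "polytime_computable D enc_pm_triple enc_wgraph pairing_graph"
proof (rule polytime_computable_exec[where i = Word and names = "[Before, After, Aux]"
      and p = graph_com])
  show "wf_com (set [Word, Before, After, Aux]) graph_com"
    by (simp add: graph_com_def load_counter_def push_edges_def push_edge_def repeat_def
        move_while_def pop_while_def symbols_def)
next
  fix x :: pm_triple
  obtain n Us1 Us2 Us3 where x: "x = (n, Us1, Us2, Us3)" by (cases x)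
  define rest where "rest = Semicolon # enc_classes n Us1 @ Semicolon # enc_classes n Us2 @
    Semicolon # enc_classes n Us3"
  have enc: "enc_pm_triple x = replicate n One @ rest"
    by (simp add: x rest_def enc_set_lessThan)
  then have "Blank \<notin> set rest" using set_enc_pm_triple[of x] by auto
  then show "\<exists>\<sigma>'. exec graph_com ((\<lambda>_. [])(Word := enc_pm_triple x))
      (poly [:9, 112, 56:] (length (enc_pm_triple x))) \<sigma>' \<and> \<sigma>' Word = enc_wgraph (pairing_graph x)"
    using exec_graph_com[of rest n] enc
    by (auto simp: rest_def pairing_graph_def x simp del: poly_pCons)
  show "set (enc_pm_triple x) \<subseteq> symbols"
    using set_enc_pm_triple[of x] unfolding symbols_def by blast
qed (simp_all add: pairing_graph_def Blank_notin_matching_graph)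

section \<open>Answering oracle queries\<close>

text \<open>A query about \<open>X\<close> is split into its four slices, which are kept on the stacks \<open>Query j\<close>.
  \<open>Passed\<close> receives the bits of a slice while it is compared with a class, \<open>Hits\<close> counts matches in
  unary, and \<open>Fault\<close> records that some capacity is exceeded.\<close>

datatype oracle_stack = Input | Spare | Query nat | Passed | Hits | Fault

abbreviation work_stacks :: "oracle_stack list" where
  "work_stacks \<equiv> [Spare, Query 0, Query 1, Query 2, Query 3, Passed, Hits, Fault]"

definition flag :: "bool \<Rightarrow> sym list" where
  "flag b = (if b then [One] else [])"

definition push_slices :: "nat \<Rightarrow> nat set \<Rightarrow> oracle_stack store \<Rightarrow> oracle_stack store" where
  "push_slices n X \<sigma> i =
     (case i of Query j \<Rightarrow> (if j < 4 then enc_set n (slice j X) else []) @ \<sigma> i | _ \<Rightarrow> \<sigma> i)"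

definition query_store :: "nat \<Rightarrow> nat set \<Rightarrow> sym list \<Rightarrow> bool \<Rightarrow> oracle_stack store" where
  "query_store n X w a = (push_slices n X (\<lambda>_. []))(Input := w, Fault := flag a)"

lemma query_store_simps [simp]:
  "query_store n X w a Input = w" "query_store n X w a Spare = []"
  "j < 4 \<Longrightarrow> query_store n X w a (Query j) = enc_set n (slice j X)"
  "query_store n X w a Passed = []" "query_store n X w a Hits = []"
  "query_store n X w a Fault = flag a"
  "(query_store n X w a)(Input := w') = query_store n X w' a"
  "(query_store n X w a)(Fault := flag a') = query_store n X w a'"
  "(query_store n X w a)(Hits := hs, Fault := flag a') = (query_store n X w a')(Hits := hs)"
  by (auto simp: query_store_def push_slices_def fun_eq_iff fun_upd_apply)

definition raise :: "oracle_stack com" where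
  "raise = pop_while Fault {One} ;; Push Fault One"

lemma exec_raise:
  assumes "\<sigma> Fault = flag a"
  shows "exec raise \<sigma> 6 (\<sigma>(Fault := flag True))"
proof -
  have "exec (pop_while Fault {One}) \<sigma> (2 * length (flag a) + 1) (\<sigma>(Fault := []))"
    by (rule exec_pop_while) (use assms in \<open>auto simp: flag_def\<close>)
  then have "exec raise \<sigma> (2 * length (flag a) + 1 + 2 + 1)
      (\<sigma>(Fault := [], Fault := One # (\<sigma>(Fault := [])) Fault))"
    unfolding raise_def by (rule exec.Seq[OF _ exec.Push])
  then have "exec raise \<sigma> (2 * length (flag a) + 1 + 2 + 1) (\<sigma>(Fault := flag True))"
    by (simp add: flag_def)
  then show ?thesis by (rule exec.weaken) (simp add: flag_def)
qed

text \<open>The capacity \<open>card U - 1\<close> of an odd copy is exceeded iff no element of \<open>U\<close> is missing, so the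
  missing elements are counted there.\<close>

definition count :: "nat \<Rightarrow> oracle_stack com" where
  "count j = Cond Input {One}
     (Cond (Query j) {if even j then One else Zero} (Push Hits One) Skip) Skip"

definition bit_symbol :: "nat set \<Rightarrow> nat \<Rightarrow> sym" where
  "bit_symbol U i = (if i \<in> U then One else Zero)"

lemma enc_set_bit_symbol: "enc_set n U = map (bit_symbol U) [0..<n]"
  by (simp add: enc_set_def bit_symbol_def)

lemma exec_count:
  assumes "peek (\<sigma> Input) = bit_symbol U i" "peek (\<sigma> (Query j)) = bit_symbol Y i"
  shows "exec (count j) \<sigma> 4
    (\<sigma>(Hits := (if i \<in> U \<and> (i \<in> Y \<longleftrightarrow> even j) then [One] else []) @ \<sigma> Hits))"
proof (cases "i \<in> U \<and> (i \<in> Y \<longleftrightarrow> even j)")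
  case True
  then have "exec (count j) \<sigma> (2 + 1 + 1) (\<sigma>(Hits := One # \<sigma> Hits))"
    unfolding count_def using assms
    by (intro exec.Cond_True exec.Push) (auto simp: bit_symbol_def)
  then show ?thesis using True by simp
next
  case False
  have "exec (count j) \<sigma> 4 \<sigma>"
  proof (cases "i \<in> U")
    case True
    then have "exec (count j) \<sigma> (1 + 1 + 1) \<sigma>"
      unfolding count_def using assms False
      by (intro exec.Cond_True exec.Cond_False exec.Skip) (auto simp: bit_symbol_def)
    then show ?thesis by (rule exec.weaken) simp
  next
    case False
    then have "exec (count j) \<sigma> (1 + 1) \<sigma>"
      unfolding count_def using assms
      by (intro exec.Cond_False exec.Skip) (auto simp: bit_symbol_def)
    then show ?thesis by (rule exec.weaken) simp
  qed
  then show ?thesis using False by (auto simp: fun_upd_idem)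
qed

definition scan :: "nat \<Rightarrow> oracle_stack com" where
  "scan j = While Input {Zero, One} (count j ;; Move Input Spare ;; Move (Query j) Passed)"

definition hits :: "nat \<Rightarrow> nat set \<Rightarrow> nat set \<Rightarrow> nat" where
  "hits j U X = card (if even j then slice j X \<inter> U else U - slice j X)"

lemma exec_scan:
  assumes "j < 4" "U \<subseteq> {..<n}" "peek rest \<notin> {Zero, One}"
  shows "exec (scan j) (query_store n X (enc_set n U @ rest) a) (11 * n + 1)
    ((query_store n X rest a)(Spare := rev (enc_set n U), Query j := [],
      Passed := rev (enc_set n (slice j X)), Hits := replicate (hits j U X) One))"
proof -
  let ?u = "bit_symbol U" and ?y = "bit_symbol (slice j X)"
  let ?P = "\<lambda>i. i \<in> U \<and> (i \<in> slice j X \<longleftrightarrow> even j)"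
  let ?body = "count j ;; Move Input Spare ;; Move (Query j) Passed"
  define S where "S ds ks = (query_store n X (map ?u ks @ rest) a)
    (Spare := rev (map ?u ds), Query j := map ?y ks, Passed := rev (map ?y ds),
     Hits := replicate (length (filter ?P ds)) One)" for ds ks
  have body: "exec ?body (S ds (i # ks)) 10 (S (ds @ [i]) ks)" for ds i ks
  proof -
    let ?\<sigma> = "(S ds (i # ks))(Hits := replicate (length (filter ?P (ds @ [i]))) One)"
    let ?\<sigma>' = "?\<sigma>(Input := map ?u ks @ rest, Spare := rev (map ?u (ds @ [i])))"
    have "exec (count j) (S ds (i # ks)) 4 ?\<sigma>"
      using exec_count[of "S ds (i # ks)" U i j "slice j X"] by (auto simp: S_def)
    moreover have "exec (Move Input Spare) ?\<sigma> 2 ?\<sigma>'"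
      using exec.Move[of Input Spare ?\<sigma>] by (simp add: S_def)
    moreover have "exec (Move (Query j) Passed) ?\<sigma>' 2 (S (ds @ [i]) ks)"
      using exec.Move[of "Query j" Passed ?\<sigma>'] by (simp add: S_def fun_upd_twist)
    ultimately have "exec ?body (S ds (i # ks)) (4 + (2 + 2 + 1) + 1) (S (ds @ [i]) ks)"
      by (intro exec.Seq)
    then show ?thesis by simp
  qed
  have "exec (scan j) (S [] [0..<n]) (length [0..<n] * (10 + 1) + 1) (S [0..<n] [])"
    unfolding scan_def
    by (rule exec_While_list[where S = S, OF _ _ body])
      (use assms in \<open>auto simp: S_def bit_symbol_def\<close>)
  moreover have "S [] [0..<n] = query_store n X (enc_set n U @ rest) a"
    using assms(1) by (simp add: S_def enc_set_bit_symbol fun_upd_idem)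
  moreover have "length (filter ?P [0..<n]) = hits j U X"
    unfolding hits_def length_filter_conv_card
    using assms(2) by (auto intro!: arg_cong[of _ _ card])
  ultimately show ?thesis by (simp add: S_def enc_set_bit_symbol mult.commute)
qed

definition overfull :: "nat \<Rightarrow> nat \<Rightarrow> bool" where
  "overfull j h \<longleftrightarrow> (if even j then h > 1 else h = 0)"

definition test_hits :: "nat \<Rightarrow> oracle_stack com" where
  "test_hits j = (if even j then Pop Hits ;; Cond Hits {One} raise Skip
     else Cond Hits {Blank} raise Skip)"

definition verdict :: "nat \<Rightarrow> oracle_stack com" where
  "verdict j = test_hits j ;; pop_while Hits {One}"

lemma exec_Cond_raise:
  assumes "\<sigma> Fault = flag a"
  shows "exec (Cond i A raise Skip) \<sigma> 7 (\<sigma>(Fault := flag (a \<or> peek (\<sigma> i) \<in> A)))"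
proof (cases "peek (\<sigma> i) \<in> A")
  case True
  then have "exec (Cond i A raise Skip) \<sigma> (6 + 1) (\<sigma>(Fault := flag True))"
    using exec_raise[of \<sigma> a] assms by (intro exec.Cond_True)
  then show ?thesis using True by simp
next
  case False
  then have "exec (Cond i A raise Skip) \<sigma> (1 + 1) \<sigma>" by (intro exec.Cond_False exec.Skip)
  then have "exec (Cond i A raise Skip) \<sigma> 7 \<sigma>" by (rule exec.weaken) simp
  then show ?thesis using False assms by (simp add: fun_upd_idem)
qed

lemma exec_test_hits:
  fixes n h a X w
  defines "S \<equiv> \<lambda>h a. (query_store n X w a)(Hits := replicate h One)"
  obtains h' where "h' \<le> h" "exec (test_hits j) (S h a) 9 (S h' (a \<or> overfull j h))"
proof (cases "even j")
  case True
  let ?a = "a \<or> overfull j h"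
  have "exec (Pop Hits) (S h a) 1 (S (h - 1) a)"
    using exec.Pop[of Hits "S h a"] by (cases h) (simp_all add: S_def)
  moreover have "peek (replicate (h - 1) One) = One \<longleftrightarrow> overfull j h"
    using True by (cases "h - 1") (auto simp: overfull_def)
  then have "exec (Cond Hits {One} raise Skip) (S (h - 1) a) 7 (S (h - 1) ?a)"
    using exec_Cond_raise[of "S (h - 1) a" a Hits "{One}"] by (simp add: S_def)
  ultimately have "exec (Pop Hits ;; Cond Hits {One} raise Skip) (S h a) (1 + 7 + 1) (S (h - 1) ?a)"
    by (rule exec.Seq)
  then show thesis using True by (intro that[of "h - 1"]) (auto simp: test_hits_def)
next
  case False
  then have "peek (replicate h One) = Blank \<longleftrightarrow> overfull j h"
    by (cases h) (auto simp: overfull_def)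
  then have "exec (Cond Hits {Blank} raise Skip) (S h a) 7 (S h (a \<or> overfull j h))"
    using exec_Cond_raise[of "S h a" a Hits "{Blank}"] by (simp add: S_def)
  then show thesis
    using False by (intro that[of h]) (auto simp: test_hits_def intro: exec.weaken)
qed

lemma exec_verdict:
  "exec (verdict j) ((query_store n X w a)(Hits := replicate h One)) (2 * h + 11)
    (query_store n X w (a \<or> overfull j h))"
proof -
  let ?S = "\<lambda>h a. (query_store n X w a)(Hits := replicate h One)" and ?a = "a \<or> overfull j h"
  obtain h' where h': "h' \<le> h" and test: "exec (test_hits j) (?S h a) 9 (?S h' ?a)"
    by (rule exec_test_hits)
  have "set (replicate h' One) \<subseteq> {One}" by auto
  then have "exec (pop_while Hits {One}) (?S h' ?a) (2 * h' + 1) (query_store n X w ?a)"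
    using exec_pop_while[of "?S h' ?a" Hits "replicate h' One" "[]" "{One}"]
    by (simp add: fun_upd_idem)
  with test have "exec (verdict j) (?S h a) (9 + (2 * h' + 1) + 1) (query_store n X w ?a)"
    unfolding verdict_def by (rule exec.Seq)
  then show ?thesis by (rule exec.weaken) (use h' in simp)
qed

lemma overfull_hits:
  assumes "U \<noteq> {}" "finite U"
  shows "overfull j (hits j U X) \<longleftrightarrow> \<not> fits j U X"
proof (cases "even j")
  case False
  have "card U = card (slice j X \<inter> U) + card (U - slice j X)"
    using assms(2) by (metis Int_commute card_Int_Diff)
  moreover have "card U > 0" using assms by (simp add: card_gt_0_iff)
  ultimately show ?thesis
    unfolding overfull_def fits_def hits_def capacity_def if_not_P[OF False] by linarith
qed (auto simp: fits_def capacity_def hits_def overfull_def)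

definition check :: "nat \<Rightarrow> oracle_stack com" where
  "check j = scan j ;; move_while Spare {Zero, One} Input ;;
     move_while Passed {Zero, One} (Query j) ;; verdict j"

lemma exec_check:
  assumes "j < 4" "U \<noteq> {}" "U \<subseteq> {..<n}" "peek rest \<notin> {Zero, One}"
  shows "exec (check j) (query_store n X (enc_set n U @ rest) a) (19 * n + 17)
    (query_store n X (enc_set n U @ rest) (a \<or> \<not> fits j U X))"
proof -
  define h where "h = hits j U X"
  have "finite U" using assms(3) finite_subset by blast
  then have "h \<le> card U" by (auto simp: h_def hits_def intro: card_mono)
  then have h: "h \<le> n" using card_mono[OF _ assms(3)] by simp
  let ?w = "enc_set n U @ rest"
  define S where "S v = (query_store n X v a)(Query j := [], Passed := rev (enc_set n (slice j X)),
    Hits := replicate h One)" for v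
  have S_simps: "S v Input = v" "S v Spare = []" "(S v)(Input := v') = S v'" for v v'
    by (auto simp: S_def query_store_def push_slices_def fun_eq_iff fun_upd_apply)
  let ?S = "(query_store n X ?w a)(Hits := replicate h One)"
  have "exec (scan j) (query_store n X ?w a) (11 * n + 1) ((S rest)(Spare := rev (enc_set n U)))"
    using exec_scan[OF assms(1,3,4), of X a] by (simp add: h_def S_def fun_upd_twist)
  moreover have "exec (move_while Spare {Zero, One} Input) ((S rest)(Spare := rev (enc_set n U)))
      (3 * n + 1) (S ?w)"
    using exec_move_while[of Spare Input "(S rest)(Spare := rev (enc_set n U))"
        "rev (enc_set n U)" "[]" "{Zero, One}"] set_enc_set[of n U]
    by (simp add: S_simps fun_upd_idem)
  moreover have "exec (move_while Passed {Zero, One} (Query j)) (S ?w) (3 * n + 1) ?S"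
    using exec_move_while[of Passed "Query j" "S ?w" "rev (enc_set n (slice j X))" "[]"
        "{Zero, One}"] set_enc_set[of n "slice j X"] assms(1)
    by (auto simp: S_def fun_upd_idem fun_upd_twist)
  moreover have "exec (verdict j) ?S (2 * h + 11)
      (query_store n X ?w (a \<or> \<not> fits j U X))"
    using exec_verdict[of j n X ?w a h] overfull_hits[OF assms(2) \<open>finite U\<close>, of j X]
    by (simp add: h_def)
  ultimately have "exec (check j) (query_store n X ?w a)
      (11 * n + 1 + (3 * n + 1 + (3 * n + 1 + (2 * h + 11) + 1) + 1) + 1)
      (query_store n X ?w (a \<or> \<not> fits j U X))"
    unfolding check_def by (intro exec.Seq)
  then show ?thesis by (rule exec.weaken) (use h in simp)
qed

primrec checks :: "nat list \<Rightarrow> oracle_stack com" where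
  "checks [] = Skip"
| "checks (j # js) = check j ;; checks js"

lemma exec_checks:
  assumes "\<forall>j\<in>set js. j < 4" "U \<noteq> {}" "U \<subseteq> {..<n}" "peek rest \<notin> {Zero, One}"
  shows "exec (checks js) (query_store n X (enc_set n U @ rest) a) (length js * (19 * n + 18) + 1)
    (query_store n X (enc_set n U @ rest) (a \<or> (\<exists>j\<in>set js. \<not> fits j U X)))"
  using assms(1)
proof (induction js arbitrary: a)
  case Nil
  show ?case using exec.Skip by simp
next
  case (Cons j js)
  let ?a = "a \<or> \<not> fits j U X"
  have "exec (check j ;; checks js) (query_store n X (enc_set n U @ rest) a)
      (19 * n + 17 + (length js * (19 * n + 18) + 1) + 1)
      (query_store n X (enc_set n U @ rest) (?a \<or> (\<exists>j\<in>set js. \<not> fits j U X)))"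
    using Cons.prems exec_check[OF _ assms(2-4)] Cons.IH[of ?a] by (intro exec.Seq) auto
  then show ?case by (simp add: disj_assoc algebra_simps)
qed

definition check_class :: "nat list \<Rightarrow> oracle_stack com" where
  "check_class js = Pop Input ;; checks js ;; pop_while Input {Zero, One}"

lemma exec_check_class:
  assumes "\<forall>j\<in>set js. j < 4" "length js \<le> 4" "U \<noteq> {}" "U \<subseteq> {..<n}" "peek rest \<notin> {Zero, One}"
  shows "exec (check_class js) (query_store n X (x # enc_set n U @ rest) a) (78 * (n + 1))
    (query_store n X rest (a \<or> (\<exists>j\<in>set js. \<not> fits j U X)))"
proof -
  let ?w = "enc_set n U @ rest" and ?a = "a \<or> (\<exists>j\<in>set js. \<not> fits j U X)"
  have "exec (Pop Input) (query_store n X (x # ?w) a) 1 (query_store n X ?w a)"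
    using exec.Pop[of Input "query_store n X (x # ?w) a"] by simp
  moreover have "exec (pop_while Input {Zero, One}) (query_store n X ?w ?a) (2 * n + 1)
      (query_store n X rest ?a)"
    using exec_pop_while[of "query_store n X ?w ?a" Input "enc_set n U" rest "{Zero, One}"]
      set_enc_set assms(5)
    by simp
  moreover note exec_checks[OF assms(1,3-5), of X a]
  ultimately have "exec (check_class js) (query_store n X (x # ?w) a)
      (1 + (length js * (19 * n + 18) + 1 + (2 * n + 1) + 1) + 1) (query_store n X rest ?a)"
    unfolding check_class_def by (intro exec.Seq)
  moreover have "length js * (19 * n + 18) \<le> 4 * (19 * n + 18)"
    using assms(2) by (rule mult_le_mono1)
  ultimately show ?thesis by (elim exec.weaken) simp
qed

definition check_section :: "nat list \<Rightarrow> oracle_stack com" where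
  "check_section js = Pop Input ;; While Input {Comma} (check_class js)"

lemma exec_check_section:
  assumes js: "\<forall>j\<in>set js. j < 4" "length js \<le> 4"
    and Us: "\<forall>U\<in>set Us. U \<noteq> {} \<and> U \<subseteq> {..<n}" and rest: "peek rest \<notin> {Zero, One, Comma}"
  shows "exec (check_section js) (query_store n X (x # enc_classes n Us @ rest) a)
    (79 * length (enc_classes n Us) + 3)
    (query_store n X rest (a \<or> (\<exists>U\<in>set Us. \<exists>j\<in>set js. \<not> fits j U X)))"
proof -
  define S where "S ds Us = query_store n X (enc_classes n Us @ rest)
    (a \<or> (\<exists>U\<in>set ds. \<exists>j\<in>set js. \<not> fits j U X))" for ds Us
  have body: "exec (check_class js) (S ds (U # Vs)) (78 * (n + 1)) (S (ds @ [U]) Vs)"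
    if "Us = ds @ U # Vs" for ds U Vs
  proof -
    have "peek (enc_classes n Vs @ rest) \<notin> {Zero, One}" using rest by (cases Vs) auto
    moreover have "U \<noteq> {}" "U \<subseteq> {..<n}" using Us that by auto
    ultimately show ?thesis
      using exec_check_class[OF js, of U n "enc_classes n Vs @ rest" X Comma
          "a \<or> (\<exists>U\<in>set ds. \<exists>j\<in>set js. \<not> fits j U X)"]
      by (simp add: S_def bex_Un disj_ac)
  qed
  have "exec (Pop Input) (query_store n X (x # enc_classes n Us @ rest) a) 1 (S [] Us)"
    using exec.Pop[of Input "query_store n X (x # enc_classes n Us @ rest) a"] by (simp add: S_def)
  moreover have "exec (While Input {Comma} (check_class js)) (S [] Us)
      (length Us * (78 * (n + 1) + 1) + 1) (S Us [])"
    by (rule exec_While_list[where S = S, OF _ _ body]) (use rest in \<open>auto simp: S_def\<close>)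
  ultimately have "exec (check_section js) (query_store n X (x # enc_classes n Us @ rest) a)
      (1 + (length Us * (78 * (n + 1) + 1) + 1) + 1) (S Us [])"
    unfolding check_section_def by (rule exec.Seq)
  then have "exec (check_section js) (query_store n X (x # enc_classes n Us @ rest) a)
      (79 * length (enc_classes n Us) + 3) (S Us [])"
    by (rule exec.weaken) (simp add: length_enc_classes algebra_simps)
  then show ?thesis by (simp add: S_def)
qed

lemma less_4_cases: "j < 4 \<Longrightarrow> j = 0 \<or> j = 1 \<or> j = 2 \<or> j = (3::nat)"
  by linarith

text \<open>The query is read from its end, because the slices are written by pushing.\<close>

definition split_query :: "oracle_stack com" where
  "split_query = While Spare {Zero, One} (Move Spare (Query 3) ;; Move Spare (Query 2) ;;
     Move Spare (Query 1) ;; Move Spare (Query 0))"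

lemma enc_set_slices:
  "enc_set (4 * Suc n) X = enc_set (4 * n) X @ map (\<lambda>j. bit_symbol (slice j X) n) [0, 1, 2, 3]"
  "enc_set (Suc n) Y = enc_set n Y @ [bit_symbol Y n]"
  by (simp_all add: enc_set_bit_symbol bit_symbol_def slice_def eval_nat_numeral)

lemma exec_split_query:
  assumes "\<sigma> Spare = rev (enc_set (4 * n) X) @ rest" "peek rest \<notin> {Zero, One}"
  shows "exec split_query \<sigma> (12 * n + 1) ((push_slices n X \<sigma>)(Spare := rest))"
  using assms(1)
proof (induction n arbitrary: \<sigma>)
  case 0
  have "push_slices 0 X \<sigma> = \<sigma>"
    by (auto simp: push_slices_def enc_set_def split: oracle_stack.split)
  then show ?case using 0 assms(2) exec.While_False[of \<sigma> Spare "{Zero, One}"]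
    by (simp add: split_query_def enc_set_def fun_upd_idem)
next
  case (Suc n)
  let ?w = "rev (enc_set (4 * n) X)" and ?b = "\<lambda>j. bit_symbol (slice j X) n"
  let ?\<sigma>3 = "\<sigma>(Spare := ?b 2 # ?b 1 # ?b 0 # ?w @ rest, Query 3 := ?b 3 # \<sigma> (Query 3))"
  let ?\<sigma>2 = "?\<sigma>3(Spare := ?b 1 # ?b 0 # ?w @ rest, Query 2 := ?b 2 # \<sigma> (Query 2))"
  let ?\<sigma>1 = "?\<sigma>2(Spare := ?b 0 # ?w @ rest, Query 1 := ?b 1 # \<sigma> (Query 1))"
  let ?\<sigma>0 = "?\<sigma>1(Spare := ?w @ rest, Query 0 := ?b 0 # \<sigma> (Query 0))"
  have spare: "\<sigma> Spare = ?b 3 # ?b 2 # ?b 1 # ?b 0 # ?w @ rest"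
    using Suc.prems unfolding enc_set_slices by simp
  have "exec (Move Spare (Query 3)) \<sigma> 2 ?\<sigma>3" "exec (Move Spare (Query 2)) ?\<sigma>3 2 ?\<sigma>2"
    "exec (Move Spare (Query 1)) ?\<sigma>2 2 ?\<sigma>1" "exec (Move Spare (Query 0)) ?\<sigma>1 2 ?\<sigma>0"
    using exec.Move[of Spare "Query 3" \<sigma>] exec.Move[of Spare "Query 2" ?\<sigma>3]
      exec.Move[of Spare "Query 1" ?\<sigma>2] exec.Move[of Spare "Query 0" ?\<sigma>1] spare
    by simp_all
  then have body: "exec (Move Spare (Query 3) ;; Move Spare (Query 2) ;; Move Spare (Query 1) ;;
      Move Spare (Query 0)) \<sigma> (2 + (2 + (2 + 2 + 1) + 1) + 1) ?\<sigma>0"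
    by (intro exec.Seq)
  have start: "peek (\<sigma> Spare) \<in> {Zero, One}" using spare by (simp add: bit_symbol_def)
  have "exec split_query ?\<sigma>0 (12 * n + 1) ((push_slices n X ?\<sigma>0)(Spare := rest))"
    by (rule Suc.IH) simp
  then have "exec split_query \<sigma> (2 + (2 + (2 + 2 + 1) + 1) + 1 + (12 * n + 1) + 1)
      ((push_slices n X ?\<sigma>0)(Spare := rest))"
    using exec.While_True[OF start body] unfolding split_query_def by blast
  moreover have "(push_slices n X ?\<sigma>0)(Spare := rest) = (push_slices (Suc n) X \<sigma>)(Spare := rest)"
    using less_4_cases
    by (auto simp: push_slices_def enc_set_slices(2) fun_eq_iff fun_upd_apply
        split: oracle_stack.split)
  ultimately show ?case by simp
qed

definition fetch_query :: "oracle_stack com" where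
  "fetch_query = move_while Input (- {Blank}) Spare ;; split_query ;; Pop Spare ;;
     move_while Spare (- {Blank}) Input"

lemma exec_fetch_query:
  assumes "Blank \<notin> set w"
  shows "exec fetch_query ((\<lambda>_. [])(Input := w @ Semicolon # enc_set (4 * n) X))
    (6 * length w + 24 * n + 10) (query_store n X w False)"
proof -
  let ?q = "enc_set (4 * n) X"
  let ?\<sigma> = "(\<lambda>_. [])(Spare := rev ?q @ Semicolon # rev w)"
  let ?S = "query_store n X"
  let ?\<sigma>' = "(?S [] False)(Spare := Semicolon # rev w)"
  have "exec (move_while Input (- {Blank}) Spare) ((\<lambda>_. [])(Input := w @ Semicolon # ?q))
      (3 * length (w @ Semicolon # ?q) + 1) ?\<sigma>"
    using exec_move_while[of Input Spare "(\<lambda>_. [])(Input := w @ Semicolon # ?q)"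
        "w @ Semicolon # ?q" "[]" "- {Blank}"] set_enc_set[of "4 * n" X] assms
    by (auto simp: fun_upd_idem)
  moreover have "(push_slices n X ?\<sigma>)(Spare := Semicolon # rev w) = ?\<sigma>'"
    by (auto simp: query_store_def push_slices_def flag_def fun_eq_iff fun_upd_apply
        split: oracle_stack.split)
  then have "exec split_query ?\<sigma> (12 * n + 1) ?\<sigma>'"
    using exec_split_query[of ?\<sigma> n X "Semicolon # rev w"] by simp
  moreover have "exec (Pop Spare) ?\<sigma>' 1 ((?S [] False)(Spare := rev w))"
    using exec.Pop[of Spare ?\<sigma>'] by simp
  moreover have "exec (move_while Spare (- {Blank}) Input) ((?S [] False)(Spare := rev w))
      (3 * length (rev w) + 1) (?S w False)"
    using exec_move_while[of Spare Input "(?S [] False)(Spare := rev w)" "rev w" "[]" "- {Blank}"]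
      assms
    by (auto simp: fun_upd_idem)
  ultimately have "exec fetch_query ((\<lambda>_. [])(Input := w @ Semicolon # enc_set (4 * n) X))
      (3 * length (w @ Semicolon # ?q) + 1 +
        (12 * n + 1 + (1 + (3 * length (rev w) + 1) + 1) + 1) + 1)
      (?S w False)"
    unfolding fetch_query_def by (intro exec.Seq)
  then show ?thesis by (rule exec.weaken) simp
qed

definition answer :: "oracle_stack com" where
  "answer = Cond Fault {One} (Push Input Zero) (Push Input One)"

lemma exec_answer:
  "exec answer (query_store n X w a) 3 (query_store n X (enc_bool (\<not> a) @ w) a)"
proof (cases a)
  case True
  then have "exec answer (query_store n X w a) (2 + 1)
      ((query_store n X w a)(Input := Zero # query_store n X w a Input))"
    unfolding answer_def by (intro exec.Cond_True exec.Push) (simp add: flag_def)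
  then show ?thesis using True by (simp add: enc_bool_def)
next
  case False
  then have "exec answer (query_store n X w a) (2 + 1)
      ((query_store n X w a)(Input := One # query_store n X w a Input))"
    unfolding answer_def by (intro exec.Cond_False exec.Push) (simp add: flag_def)
  then show ?thesis using False by (simp add: enc_bool_def)
qed

definition oracle_com :: "(nat \<Rightarrow> nat) \<Rightarrow> oracle_stack com" where
  "oracle_com src = (let check = (\<lambda>s. check_section (filter (\<lambda>j. src j = s) [0..<4])) in
     fetch_query ;; pop_while Input {One} ;; check 0 ;; check 1 ;; check 2 ;; answer)"

lemma exec_check_section_classes:
  assumes "pm_triple_instance x" "s < 3" "peek rest \<notin> {Zero, One, Comma}"
  shows "exec (check_section (filter (\<lambda>j. src j = s) [0..<4]))
    (query_store (fst x) X (y # enc_classes (fst x) (classes x s) @ rest) a)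
    (79 * length (enc_classes (fst x) (classes x s)) + 3)
    (query_store (fst x) X rest (a \<or> (\<exists>U\<in>set (classes x s). \<exists>j<4. src j = s \<and> \<not> fits j U X)))"
proof -
  let ?js = "filter (\<lambda>j. src j = s) [0..<4]"
  have "length ?js \<le> 4" using length_filter_le[of _ "[0..<4]"] by simp
  moreover have "(\<exists>j\<in>set ?js. \<not> fits j U X) \<longleftrightarrow> (\<exists>j<4. src j = s \<and> \<not> fits j U X)" for U by auto
  ultimately show ?thesis
    using exec_check_section[of ?js "classes x s" "fst x" rest X y a] assms(3)
      partition_on_classD[OF partition_on_classes[OF assms(1,2)] finite_lessThan]
    by fastforce
qed

lemma exec_oracle_com:
  fixes X
  assumes x: "pm_triple_instance x" and src: "\<And>j. j < 4 \<Longrightarrow> src j < 3"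
  defines "ok \<equiv> \<forall>j<4. \<forall>U\<in>set (classes x (src j)). fits j U X"
    and "u \<equiv> enc_pm_triple x @ Semicolon # enc_set (4 * fst x) X"
  shows "exec (oracle_com src) ((\<lambda>_. [])(Input := u)) (poly [:30, 90:] (length u))
    (query_store (fst x) X (enc_bool ok) (\<not> ok))"
proof -
  let ?n = "fst x"
  let ?c = "\<lambda>s. enc_classes ?n (classes x s)" and ?S = "query_store ?n X"
  let ?w = "Semicolon # ?c 0 @ Semicolon # ?c 1 @ Semicolon # ?c 2"
  define fault where "fault s \<longleftrightarrow> (\<exists>U\<in>set (classes x s). \<exists>j<4. src j = s \<and> \<not> fits j U X)" for s
  have enc: "enc_pm_triple x = replicate ?n One @ ?w"
    by (cases x) (simp add: enc_set_lessThan numeral_2_eq_2)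
  note check = exec_check_section_classes[OF x, of _ _ src X, folded fault_def]
  have "fault 0 \<or> fault 1 \<or> fault 2 \<longleftrightarrow> (\<exists>s<3. fault s)"
    by (simp add: numeral_3_eq_3 Ex_less_Suc2 numeral_2_eq_2)
  also have "\<dots> \<longleftrightarrow> \<not> ok" using src by (auto simp: ok_def fault_def)
  finally have fault: "((False \<or> fault 0) \<or> fault 1) \<or> fault 2 \<longleftrightarrow> \<not> ok" by simp
  have "exec fetch_query ((\<lambda>_. [])(Input := u)) (6 * length (enc_pm_triple x) + 24 * ?n + 10)
      (?S (enc_pm_triple x) False)"
    unfolding u_def using set_enc_pm_triple[of x] by (intro exec_fetch_query) auto
  moreover have "exec (pop_while Input {One}) (?S (enc_pm_triple x) False)
      (2 * length (replicate ?n One) + 1) ((?S (enc_pm_triple x) False)(Input := ?w))"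
    by (rule exec_pop_while) (auto simp: enc)
  then have "exec (pop_while Input {One}) (?S (enc_pm_triple x) False) (2 * ?n + 1) (?S ?w False)"
    by simp
  moreover note check[of 0 "Semicolon # ?c 1 @ Semicolon # ?c 2" Semicolon False]
    check[of 1 "Semicolon # ?c 2" Semicolon "False \<or> fault 0"]
    check[of 2 "[]" Semicolon "(False \<or> fault 0) \<or> fault 1", unfolded fault append_Nil2]
  moreover have "exec answer (?S [] (\<not> ok)) 3 (?S (enc_bool ok) (\<not> ok))"
    using exec_answer[of ?n X "[]" "\<not> ok"] by simp
  ultimately have "exec (oracle_com src) ((\<lambda>_. [])(Input := u))
      (6 * length (enc_pm_triple x) + 24 * ?n + 10 + (2 * ?n + 1 + (79 * length (?c 0) + 3 +
        (79 * length (?c 1) + 3 + (79 * length (?c 2) + 3 + 3 + 1) + 1) + 1) + 1) + 1)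
      (?S (enc_bool ok) (\<not> ok))"
    unfolding oracle_com_def Let_def by (intro exec.Seq) simp_all
  then show ?thesis by (rule exec.weaken) (simp add: u_def enc)
qed

lemma wf_check_section:
  assumes "\<forall>j\<in>set js. j < 4"
  shows "wf_com (set (Input # work_stacks)) (check_section js)"
proof -
  have "wf_com (set (Input # work_stacks)) (check j)" if "j < 4" for j
    using that by (auto simp: check_def scan_def count_def verdict_def test_hits_def raise_def
        move_while_def pop_while_def symbols_def)
  then have "wf_com (set (Input # work_stacks)) (checks js)"
    using assms by (induction js) auto
  then show ?thesis by (simp add: check_section_def check_class_def pop_while_def)
qed

lemma wf_oracle_com: "wf_com (set (Input # work_stacks)) (oracle_com src)"
  using wf_check_section
  by (simp add: oracle_com_def fetch_query_def split_query_def answer_def move_while_def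
      pop_while_def symbols_def)

lemma polytime_lifted_matroid:
  assumes src: "\<And>j. j < 4 \<Longrightarrow> src j < 3"
  shows "polytime_oracle (Collect pm_triple_instance) enc_pm_triple pairing_graph
    (\<lambda>x. lifted_matroid (copied_classes src x))"
  unfolding polytime_oracle_def
proof (rule polytime_computable_exec[OF _ wf_oracle_com[of src]])
  let ?enc = "\<lambda>(x, X). enc_pm_triple x @ Semicolon # enc_set (card (wg_verts (pairing_graph x))) X"
  fix y assume "y \<in> {(x, X). x \<in> Collect pm_triple_instance \<and> X \<subseteq> wg_verts (pairing_graph x)}"
  then obtain x X where y: "y = (x, X)" and x: "pm_triple_instance x" and X: "X \<subseteq> {..<4 * fst x}"
    by (auto simp: pairing_graph_def wg_verts_matching_graph simp del: pm_triple_instance.simps)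
  interpret four_partitions "fst x" "copied_classes src x"
    using x src by (rule four_partitions_copied_classes)
  have enc: "?enc y = enc_pm_triple x @ Semicolon # enc_set (4 * fst x) X"
    by (simp add: y pairing_graph_def wg_verts_matching_graph)
  show "\<exists>\<sigma>'. exec (oracle_com src) ((\<lambda>_. [])(Input := ?enc y))
      (poly [:30, 90:] (length (?enc y))) \<sigma>' \<and>
      \<sigma>' Input = enc_bool (case y of (x, X) \<Rightarrow> X \<in> lifted_matroid (copied_classes src x))"
    unfolding enc using exec_oracle_com[OF x src, where X = X] X
    by (intro exI conjI) (assumption, simp add: y lifted_matroid_iff copied_classes_def)
  show "set (?enc y) \<subseteq> symbols"
    unfolding enc using set_enc_pm_triple[of x] set_enc_set[of "4 * fst x" X]
    by (auto simp: symbols_def)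
qed (auto simp: enc_bool_def)

theorem theorem11:
  "\<exists>(G :: pm_triple \<Rightarrow> wgraph) (\<I>1 :: pm_triple \<Rightarrow> nat set set) (\<I>2 :: pm_triple \<Rightarrow> nat set set).
     polytime_computable (Collect pm_triple_instance) enc_pm_triple enc_wgraph G \<and>
     polytime_oracle (Collect pm_triple_instance) enc_pm_triple G \<I>1 \<and>
     polytime_oracle (Collect pm_triple_instance) enc_pm_triple G \<I>2 \<and>
     (\<forall>x. pm_triple_instance x \<longrightarrow>
        wf_wgraph (G x) \<and>
        (\<exists>k. cmmc_instance (wg_verts (G x)) (wg_edges (G x)) (wg_weight (G x)) (\<I>1 x) (\<I>2 x) k \<and>
             (has_common_basis x \<longleftrightarrow>
              cmmc_opt (wg_verts (G x)) (wg_edges (G x)) (wg_weight (G x)) (\<I>1 x) (\<I>2 x) k = 0)))"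
proof (rule exI[of _ pairing_graph], rule exI[of _ first_matroid], rule exI[of _ second_matroid],
    intro conjI allI impI)
  show "polytime_computable (Collect pm_triple_instance) enc_pm_triple enc_wgraph pairing_graph"
    by (rule polytime_pairing_graph)
  show "polytime_oracle (Collect pm_triple_instance) enc_pm_triple pairing_graph first_matroid"
    unfolding first_matroid_def by (rule polytime_lifted_matroid) (rule source_less_3)
  show "polytime_oracle (Collect pm_triple_instance) enc_pm_triple pairing_graph second_matroid"
    unfolding second_matroid_def by (rule polytime_lifted_matroid) (rule source_less_3)
  fix x assume x: "pm_triple_instance x"
  show "wf_wgraph (pairing_graph x)" by (simp add: pairing_graph_def wf_matching_graph)
  show "\<exists>k. cmmc_instance (wg_verts (pairing_graph x)) (wg_edges (pairing_graph x))
        (wg_weight (pairing_graph x)) (first_matroid x) (second_matroid x) k \<and>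
      (has_common_basis x \<longleftrightarrow> cmmc_opt (wg_verts (pairing_graph x)) (wg_edges (pairing_graph x))
        (wg_weight (pairing_graph x)) (first_matroid x) (second_matroid x) k = 0)"
    using pairing_reduction[OF x] by blast
qed

end
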